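(* Let $k\geq 3$ be an odd integer, let $G$ be a connected graph of order $n\geq 3$, and let $d$ be an integer with $1\le d<k$ and $n\equiv d\pmod 2$. (i) If $n$ is odd, or $n$ is even with $n\geq 10$, and $\lambda_1(D(G))\le \lambda_1(D(K_1\vee(K_{n-2}\cup K_1)))$, then $G$ is $k$-$d$-critical unless $G\cong K_1\vee(K_{n-2}\cup K_1)$. (ii) If $n$ is even with $4\le n\le 8$ and $\lambda_1(D(G))\le \lambda_1(D(S_{n,\frac{n}{2}}))$, then $G$ is $k$-$d$-critical unless $G\cong S_{n,\frac{n}{2}}$.
   Context: All graphs are finite, simple, undirected. For a connected graph $G$ with vertices $v_1,\dots,v_n$, the distance matrix $D(G)$ is the $n\times n$ matrix whose $(i,j)$-entry is the distance $d_G(v_i,v_j)$; $\lambda_1(D(G))$ denotes its largest eigenvalue. $G\cup H$ is the disjoint union, $G\vee H$ the join, $tK_1$ the edgeless graph on $t$ vertices, and $S_{n,k}=K_k\vee (n-k)K_1$. For a vertex $v$, $E_G(v)$ is the set of edges incident with $v$. A $k$-matching of $G$ is a function $h:E(G)\to\{0,1,\dots,k\}$ with $\sum_{e\in E_G(v)}h(e)\le k$ for every $v\in V(G)$. For odd $k\ge 3$, $1\le d\le k$ and $|V(G)|\equiv d\pmod 2$, $G$ is called $k$-$d$-critical if for every $v\in V(G)$ there is a $k$-matching $h$ with $\sum_{e\in E_G(v)}h(e)=k-d$ and $\sum_{e\in E_G(u)}h(e)=k$ for every $u\in V(G)\setminus\{v\}$. *)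

theory Defs
  imports Complex_Main
begin

definition simple_graph :: "'a set \<Rightarrow> 'a set set \<Rightarrow> bool" where
  "simple_graph V E \<longleftrightarrow> finite V \<and> (\<forall>e\<in>E. \<exists>u v. e = {u, v} \<and> u \<noteq> v \<and> u \<in> V \<and> v \<in> V)"

definition adj :: "'a set set \<Rightarrow> 'a \<Rightarrow> 'a \<Rightarrow> bool" where
  "adj E u v \<longleftrightarrow> {u, v} \<in> E"

definition is_walk :: "'a set \<Rightarrow> 'a set set \<Rightarrow> 'a list \<Rightarrow> 'a \<Rightarrow> 'a \<Rightarrow> nat \<Rightarrow> bool" where
  "is_walk V E xs u v m \<longleftrightarrow> xs \<noteq> [] \<and> length xs = Suc m \<and> hd xs = u \<and> last xs = v
     \<and> set xs \<subseteq> V \<and> successively (adj E) xs"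

definition connected_graph :: "'a set \<Rightarrow> 'a set set \<Rightarrow> bool" where
  "connected_graph V E \<longleftrightarrow> (\<forall>u\<in>V. \<forall>v\<in>V. \<exists>xs m. is_walk V E xs u v m)"

definition gdist :: "'a set \<Rightarrow> 'a set set \<Rightarrow> 'a \<Rightarrow> 'a \<Rightarrow> nat" where
  "gdist V E u v = (LEAST m. \<exists>xs. is_walk V E xs u v m)"

definition dist_eigenvalue :: "'a set \<Rightarrow> 'a set set \<Rightarrow> real \<Rightarrow> bool" where
  "dist_eigenvalue V E \<mu> \<longleftrightarrow> (\<exists>x :: 'a \<Rightarrow> real. (\<exists>u\<in>V. x u \<noteq> 0) \<and>
      (\<forall>u\<in>V. (\<Sum>w\<in>V. real (gdist V E u w) * x w) = \<mu> * x u))"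

definition dist_lambda1 :: "'a set \<Rightarrow> 'a set set \<Rightarrow> real" where
  "dist_lambda1 V E = Max {\<mu>. dist_eigenvalue V E \<mu>}"

definition graph_iso :: "'a set \<Rightarrow> 'a set set \<Rightarrow> 'b set \<Rightarrow> 'b set set \<Rightarrow> bool" where
  "graph_iso V E V' E' \<longleftrightarrow> (\<exists>f. bij_betw f V V' \<and>
      (\<forall>u\<in>V. \<forall>v\<in>V. {u, v} \<in> E \<longleftrightarrow> {f u, f v} \<in> E'))"

text \<open>K_1 \<or> (K_{n-2} \<union> K_1) on {0..<n}: vertex 0 is the joined K_1,
  vertices 0..n-2 form a clique K_{n-1}, vertex n-1 is adjacent only to 0.\<close>
definition KKK_edges :: "nat \<Rightarrow> nat set set" where
  "KKK_edges n = {{i, j} | i j. i \<noteq> j \<and> i < n \<and> j < n \<and>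
      ((i < n - 1 \<and> j < n - 1) \<or> i = 0 \<or> j = 0)}"

text \<open>S_{n,k} = K_k \<or> (n-k)K_1 on {0..<n}: vertices 0..k-1 form the clique.\<close>
definition S_edges :: "nat \<Rightarrow> nat \<Rightarrow> nat set set" where
  "S_edges n k = {{i, j} | i j. i \<noteq> j \<and> i < n \<and> j < n \<and> (i < k \<or> j < k)}"

definition hdeg :: "'a set set \<Rightarrow> ('a set \<Rightarrow> nat) \<Rightarrow> 'a \<Rightarrow> nat" where
  "hdeg E h v = (\<Sum>e\<in>{e\<in>E. v \<in> e}. h e)"

definition k_matching :: "'a set \<Rightarrow> 'a set set \<Rightarrow> nat \<Rightarrow> ('a set \<Rightarrow> nat) \<Rightarrow> bool" where
  "k_matching V E k h \<longleftrightarrow> (\<forall>e\<in>E. h e \<le> k) \<and> (\<forall>v\<in>V. hdeg E h v \<le> k)"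

definition k_d_critical :: "'a set \<Rightarrow> 'a set set \<Rightarrow> nat \<Rightarrow> nat \<Rightarrow> bool" where
  "k_d_critical V E k d \<longleftrightarrow> (\<forall>v\<in>V. \<exists>h. k_matching V E k h \<and> hdeg E h v = k - d \<and>
      (\<forall>u\<in>V - {v}. hdeg E h u = k))"

end

theory Submission
  imports Defs "HOL-Analysis.Function_Topology"
begin

text \<open>
A vector of vertex degrees b is realised by an edge weighting iff the graph obtained by replacing each
vertex v by b v independent twins has a perfect matching, so Tutte's theorem produces, for a graph that
is not critical, a nonempty set S such that G - S has either at least |S| isolated vertices or many
components with at least three vertices.

In the second case so many pairs are nonadjacent that the all-ones vector already gives
\<open>\<lambda>\<^sub>1 > n + 2 \<ge> \<lambda>\<^sub>1(K\<^sub>1 \<or> (K\<^sub>n\<^sub>-\<^sub>2 \<union> K\<^sub>1))\<close>.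
In the first case G is a spanning subgraph of the join of a clique of order s = |S| with the disjoint
union of s isolated vertices and a clique. For the extremal value of s the Perron vector yields strict
monotonicity of the spectral radius; for other s the Perron vector of the extremal graph (with one
vertex of the independent set in the role of the pendant vertex) is a sufficient test vector, apart
from finitely many small parameters that are settled with explicit rational test vectors.
\<close>

text \<open>Criticality at v asks for weights realising the demand k - d at v and k elsewhere. Since
  d < k, every demand is positive, so no vertex vanishes in the blow-up; since k is odd and n has
  the parity of d, the total demand is even, so a Tutte barrier has excess at least two. A component
  of G - S that is neither isolated nor contains v has demand k times its order, hence is odd only
  if its order is odd, hence at least three: this is the origin of the number three. Two candidates
  compete. Writing r for the number n - 2s of remaining vertices, s = 1 leads to the graph with a
  pendant vertex, and r = 0 to the join of n/2 clique vertices with n/2 independent ones. Their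
  spectral radii cross between n = 8 (above 8.776 against about 8.772) and n = 10 (at most 11.3
  against about 11.385). This crossing separates the two parts of the theorem and leaves very little
  room for the test vectors at n = 8. On the spectral side the largest eigenvalue is a
  \<open>Max\<close> over a set of reals, so finiteness of the spectrum has to be established before
  Rayleigh quotients can bound it.\<close>

section \<open>Tutte's theorem\<close>

text \<open>Halmos-Vaughan induction. If some proper nonempty K is tight, K and its complement are
  solved separately, the complement with the values of K removed. If none is tight, every proper
  nonempty J has a value to spare, so one index may be given an arbitrary value y.\<close>

lemma hall_marriage:
  assumes "finite I" and "\<And>i. i \<in> I \<Longrightarrow> finite (N i)"
    and "\<And>J. J \<subseteq> I \<Longrightarrow> card J \<le> card (\<Union>(N ` J))"
  shows "\<exists>f. inj_on f I \<and> (\<forall>i\<in>I. f i \<in> N i)"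
  using assms
proof (induction "card I" arbitrary: I N rule: less_induct)
  case (less I N)
  show ?case
  proof (cases "\<exists>K. K \<subset> I \<and> K \<noteq> {} \<and> card K = card (\<Union>(N ` K))")
    case True
    then obtain K where K: "K \<subset> I" "K \<noteq> {}" "card K = card (\<Union>(N ` K))" by blast
    define M where "M i = N i - \<Union>(N ` K)" for i
    have cK: "card K < card I" by (rule psubset_card_mono[OF less.prems(1) K(1)])
    have "\<exists>f. inj_on f K \<and> (\<forall>i\<in>K. f i \<in> N i)"
    proof (rule less.hyps[OF cK])
      show "finite K" using K(1) less.prems(1) finite_subset by blast
      show "finite (N i)" if "i \<in> K" for i using that K(1) less.prems(2) by blast
      show "card J \<le> card (\<Union>(N ` J))" if "J \<subseteq> K" for J using that K(1) less.prems(3) by blast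
    qed
    then obtain f where f: "inj_on f K" "\<forall>i\<in>K. f i \<in> N i" by blast
    have "\<exists>g. inj_on g (I - K) \<and> (\<forall>i\<in>I - K. g i \<in> M i)"
    proof (rule less.hyps)
      show "card (I - K) < card I"
        by (rule psubset_card_mono[OF less.prems(1)]) (use K in auto)
      show "finite (I - K)" using less.prems(1) by simp
      show "finite (M i)" if "i \<in> I - K" for i using that less.prems(2) by (simp add: M_def)
      show "card J \<le> card (\<Union>(M ` J))" if J: "J \<subseteq> I - K" for J
      proof -
        have fin: "finite J" "finite K" using J K less.prems(1) by (auto intro: finite_subset)
        have "card J + card K = card (J \<union> K)" using J fin by (subst card_Un_disjoint) auto
        also have "\<dots> \<le> card (\<Union>(N ` (J \<union> K)))" using less.prems(3)[of "J \<union> K"] J K by blast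
        also have "\<Union>(N ` (J \<union> K)) = \<Union>(M ` J) \<union> \<Union>(N ` K)" by (auto simp: M_def)
        also have "card \<dots> \<le> card (\<Union>(M ` J)) + card (\<Union>(N ` K))" by (rule card_Un_le)
        finally show ?thesis using K(3) by simp
      qed
    qed
    then obtain g where g: "inj_on g (I - K)" "\<forall>i\<in>I - K. g i \<in> M i" by blast
    define h where "h i = (if i \<in> K then f i else g i)" for i
    have fg: "f a \<noteq> g c" if "a \<in> K" "c \<in> I - K" for a c
    proof -
      have "f a \<in> N a" "g c \<notin> \<Union>(N ` K)" using f(2) g(2) that by (auto simp: M_def)
      then show ?thesis using that(1) by auto
    qed
    have "inj_on h I"
    proof (rule inj_onI)
      fix i j assume ij: "i \<in> I" "j \<in> I" "h i = h j"
      then show "i = j"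
        using fg[of i j] fg[of j i] inj_onD[OF f(1), of i j] inj_onD[OF g(1), of i j]
        by (auto simp: h_def split: if_splits)
    qed
    moreover have "\<forall>i\<in>I. h i \<in> N i" using f g by (auto simp: h_def M_def)
    ultimately show ?thesis by blast
  next
    case False
    show ?thesis
    proof (cases "I = {}")
      case False
      then obtain i where i: "i \<in> I" by blast
      have "card {i} \<le> card (\<Union>(N ` {i}))" using less.prems(3)[of "{i}"] i by blast
      then obtain y where y: "y \<in> N i" by (cases "N i = {}") auto
      define M where "M j = N j - {y}" for j
      have "\<exists>g. inj_on g (I - {i}) \<and> (\<forall>j\<in>I - {i}. g j \<in> M j)"
      proof (rule less.hyps)
        show "card (I - {i}) < card I" by (rule card_Diff1_less[OF less.prems(1) i])
        show "finite (I - {i})" using less.prems(1) by simp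
        show "finite (M j)" if "j \<in> I - {i}" for j using that less.prems(2) by (simp add: M_def)
        show "card J \<le> card (\<Union>(M ` J))" if J: "J \<subseteq> I - {i}" for J
        proof (cases "J = {}")
          case False
          have "J \<subset> I" using J i by blast
          then have "card J \<noteq> card (\<Union>(N ` J))" "card J \<le> card (\<Union>(N ` J))"
            using \<open>\<not> (\<exists>K. _ K)\<close> False less.prems(3)[of J] by blast+
          moreover have "\<Union>(M ` J) = \<Union>(N ` J) - {y}" by (auto simp: M_def)
          ultimately show ?thesis
            using card_Diff1_le[of "\<Union>(N ` J)" y] card_Diff_singleton_if[of "\<Union>(N ` J)" y]
            by (simp split: if_splits)
        qed simp
      qed
      then obtain g where g: "inj_on g (I - {i})" "\<forall>j\<in>I - {i}. g j \<in> M j" by blast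
      have "inj_on (g(i := y)) I"
        using g unfolding inj_on_def M_def by auto
      moreover have "\<forall>j\<in>I. (g(i := y)) j \<in> N j" using g y by (auto simp: M_def)
      ultimately show ?thesis by blast
    qed auto
  qed
qed

section \<open>Components of induced subgraphs and their parity\<close>

definition reach :: "('a \<Rightarrow> 'a \<Rightarrow> bool) \<Rightarrow> 'a set \<Rightarrow> 'a rel" where
  "reach A W = {(x, y). x \<in> W \<and> y \<in> W \<and> A x y}\<^sup>*"

text \<open>The relation A stays fixed and only the vertex set W varies, so that deleting S is the
  set difference W - S. The reflexive closure puts x into its own component even for x outside
  W.\<close>

definition conn_comp :: "('a \<Rightarrow> 'a \<Rightarrow> bool) \<Rightarrow> 'a set \<Rightarrow> 'a \<Rightarrow> 'a set" where
  "conn_comp A W x = {y. (x, y) \<in> reach A W}"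

definition conn_comps :: "('a \<Rightarrow> 'a \<Rightarrow> bool) \<Rightarrow> 'a set \<Rightarrow> 'a set set" where
  "conn_comps A W = conn_comp A W ` W"

definition odd_comps :: "('a \<Rightarrow> 'a \<Rightarrow> bool) \<Rightarrow> 'a set \<Rightarrow> nat" where
  "odd_comps A W = card {C \<in> conn_comps A W. odd (card C)}"

text \<open>A matching is encoded as an involution on W. Fixed points are excluded only through
  irreflexivity of A.\<close>

definition perfect_matching :: "('a \<Rightarrow> 'a \<Rightarrow> bool) \<Rightarrow> 'a set \<Rightarrow> ('a \<Rightarrow> 'a) \<Rightarrow> bool" where
  "perfect_matching A W m \<longleftrightarrow> (\<forall>x\<in>W. m x \<in> W \<and> m (m x) = x \<and> A x (m x))"

lemma conn_comp_self: "x \<in> conn_comp A W x"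
  by (simp add: conn_comp_def reach_def)

lemma conn_comp_subset: "x \<in> W \<Longrightarrow> conn_comp A W x \<subseteq> W"
proof
  fix y assume "x \<in> W" "y \<in> conn_comp A W x"
  then have "(x, y) \<in> {(x, y). x \<in> W \<and> y \<in> W \<and> A x y}\<^sup>*" by (simp add: conn_comp_def reach_def)
  then show "y \<in> W" using \<open>x \<in> W\<close> by (induction) auto
qed

lemma conn_comp_step:
  "y \<in> conn_comp A W x \<Longrightarrow> y \<in> W \<Longrightarrow> z \<in> W \<Longrightarrow> A y z \<Longrightarrow> z \<in> conn_comp A W x"
  unfolding conn_comp_def reach_def by (auto intro: rtrancl_into_rtrancl)

lemma reach_sym: "symp A \<Longrightarrow> (x, y) \<in> reach A W \<Longrightarrow> (y, x) \<in> reach A W"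
  unfolding reach_def
  by (rule symD[OF sym_rtrancl]) (auto simp: sym_def symp_def)

lemma conn_comp_eq: "symp A \<Longrightarrow> y \<in> conn_comp A W x \<Longrightarrow> conn_comp A W y = conn_comp A W x"
  unfolding conn_comp_def using reach_sym[of A] by (auto simp: reach_def intro: rtrancl_trans)

lemma conn_comps_disjoint:
  "symp A \<Longrightarrow> C \<in> conn_comps A W \<Longrightarrow> C' \<in> conn_comps A W \<Longrightarrow> x \<in> C \<Longrightarrow> x \<in> C' \<Longrightarrow> C = C'"
  unfolding conn_comps_def using conn_comp_eq by (metis imageE)

lemma Union_conn_comps: "\<Union>(conn_comps A W) = W"
  unfolding conn_comps_def using conn_comp_subset[of _ W A] conn_comp_self by fast

lemma conn_comps_nonempty: "C \<in> conn_comps A W \<Longrightarrow> C \<noteq> {}"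
  unfolding conn_comps_def using conn_comp_self by fast

lemma conn_comps_subset: "C \<in> conn_comps A W \<Longrightarrow> C \<subseteq> W"
  by (subst Union_conn_comps[of A W, symmetric]) blast

lemma finite_conn_comps: "finite W \<Longrightarrow> finite (conn_comps A W)"
  by (simp add: conn_comps_def)

lemma conn_comps_closed:
  assumes "C \<in> conn_comps A W" "x \<in> C" "y \<in> W" "A x y"
  shows "y \<in> C"
proof -
  obtain z where z: "z \<in> W" "C = conn_comp A W z" using assms(1) unfolding conn_comps_def by blast
  then show ?thesis using conn_comp_step[of x A W z y] assms conn_comps_subset[OF assms(1)] by blast
qed

lemma conn_comp_Un_left:
  assumes "\<And>x y. x \<in> X \<Longrightarrow> y \<in> Y \<Longrightarrow> \<not> A x y" and "x \<in> X"
  shows "conn_comp A (X \<union> Y) x = conn_comp A X x"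
proof
  show "conn_comp A X x \<subseteq> conn_comp A (X \<union> Y) x"
  proof -
    have "{(x, y). x \<in> X \<and> y \<in> X \<and> A x y}\<^sup>* \<subseteq> {(x, y). x \<in> X \<union> Y \<and> y \<in> X \<union> Y \<and> A x y}\<^sup>*"
      by (rule rtrancl_mono) auto
    then show ?thesis unfolding conn_comp_def reach_def by blast
  qed
  show "conn_comp A (X \<union> Y) x \<subseteq> conn_comp A X x"
  proof
    fix y assume "y \<in> conn_comp A (X \<union> Y) x"
    then have "(x, y) \<in> {(x, y). x \<in> X \<union> Y \<and> y \<in> X \<union> Y \<and> A x y}\<^sup>*" by (simp add: conn_comp_def reach_def)
    then show "y \<in> conn_comp A X x"
    proof induction
      case base show ?case by (rule conn_comp_self)
    next
      case (step y z)
      then have "y \<in> X" using conn_comp_subset[OF assms(2)] by blast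
      then have "z \<in> X" using step(2) assms(1) by blast
      then show ?case using conn_comp_step[OF step(3) \<open>y \<in> X\<close>] step(2) by blast
    qed
  qed
qed

lemma conn_comps_Un:
  assumes "symp A" and "\<And>x y. x \<in> X \<Longrightarrow> y \<in> Y \<Longrightarrow> \<not> A x y"
  shows "conn_comps A (X \<union> Y) = conn_comps A X \<union> conn_comps A Y"
proof -
  have "\<And>x y. x \<in> Y \<Longrightarrow> y \<in> X \<Longrightarrow> \<not> A x y" using assms by (meson sympD)
  then have "conn_comp A (X \<union> Y) ` Y = conn_comp A Y ` Y"
    using conn_comp_Un_left[of Y X A] by (simp add: Un_commute)
  then show ?thesis
    unfolding conn_comps_def using conn_comp_Un_left[of X Y A] assms(2) by (simp add: image_Un)
qed

lemma odd_comps_Un: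
  assumes "symp A" "finite X" "finite Y" "X \<inter> Y = {}" "\<And>x y. x \<in> X \<Longrightarrow> y \<in> Y \<Longrightarrow> \<not> A x y"
  shows "odd_comps A (X \<union> Y) = odd_comps A X + odd_comps A Y"
proof -
  have "{C \<in> conn_comps A (X \<union> Y). odd (card C)} =
      {C \<in> conn_comps A X. odd (card C)} \<union> {C \<in> conn_comps A Y. odd (card C)}"
    using conn_comps_Un[OF assms(1,5)] by auto
  moreover have "conn_comps A X \<inter> conn_comps A Y = {}"
    using conn_comps_subset[of _ A] conn_comps_nonempty[of _ A] assms(4) by blast
  ultimately show ?thesis unfolding odd_comps_def
    using finite_conn_comps[OF assms(2), of A] finite_conn_comps[OF assms(3), of A]
    by (subst card_Un_disjoint[symmetric]) auto
qed

lemma conn_comps_of_conn_comp: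
  assumes "symp A" "C \<in> conn_comps A W"
  shows "conn_comps A C = {C}"
proof -
  have W: "W = C \<union> (W - C)" using conn_comps_subset[OF assms(2)] by blast
  have "conn_comp A C x = C" if "x \<in> C" for x
  proof -
    have "conn_comp A C x = conn_comp A W x"
    proof -
      have "conn_comp A (C \<union> (W - C)) x = conn_comp A C x"
        by (rule conn_comp_Un_left) (use conn_comps_closed[OF assms(2)] that in blast)+
      then show ?thesis using W by simp
    qed
    also have "\<dots> = C"
    proof -
      obtain y where "y \<in> W" "C = conn_comp A W y" using assms(2) unfolding conn_comps_def by blast
      then show ?thesis using conn_comp_eq[OF assms(1), of x W y] that by simp
    qed
    finally show ?thesis .
  qed
  then show ?thesis unfolding conn_comps_def using conn_comps_nonempty[OF assms(2)] by auto
qed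

lemma odd_comps_conn_comp:
  assumes "symp A" "C \<in> conn_comps A W"
  shows "odd_comps A C = (if odd (card C) then 1 else 0)"
proof -
  have "{X \<in> conn_comps A C. odd (card X)} = (if odd (card C) then {C} else {})"
    unfolding conn_comps_of_conn_comp[OF assms] by auto
  then show ?thesis unfolding odd_comps_def by simp
qed

lemma odd_comps_split:
  assumes "symp A" "finite W" "C \<in> conn_comps A W" "D \<subseteq> C"
  shows "odd_comps A (W - C \<union> D) = odd_comps A (W - C) + odd_comps A D"
proof (rule odd_comps_Un)
  show "finite D"
    by (rule finite_subset[OF _ assms(2)]) (use assms(4) conn_comps_subset[OF assms(3)] in auto)
  show "\<not> A x y" if "x \<in> W - C" "y \<in> D" for x y
  proof
    assume "A x y"
    then have "A y x" using assms(1) by (rule sympD[rotated])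
    then show False using conn_comps_closed[OF assms(3), of y x] that assms(4) by blast
  qed
  show "(W - C) \<inter> D = {}" "finite (W - C)" using assms(2,4) by auto
qed (rule assms(1))

lemma odd_comps_parity:
  assumes "symp A" "finite W"
  shows "even (odd_comps A W) \<longleftrightarrow> even (card W)"
proof -
  have "card W = sum card (conn_comps A W)"
  proof -
    have "pairwise disjnt (conn_comps A W)"
      by (rule pairwiseI) (use conn_comps_disjoint[OF assms(1)] in \<open>auto simp: disjnt_iff\<close>)
    moreover have "\<And>C. C \<in> conn_comps A W \<Longrightarrow> finite C"
      by (rule finite_subset[OF conn_comps_subset assms(2)])
    ultimately show ?thesis
      using card_Union_disjoint[of "conn_comps A W"] Union_conn_comps[of A W] by simp
  qed
  then show ?thesis
    using even_sum_iff[OF finite_conn_comps[OF assms(2), of A], of card]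
    by (simp add: odd_comps_def)
qed

text \<open>Take a tight set S (as many odd components as elements) of greatest cardinality.
  Maximality forces every component C of W - S to be odd and makes C minus any vertex satisfy
  Tutte's condition again. Hall's theorem matches the components into S; their number is |S|, so all
  of S is used, and induction matches what is left of each component.\<close>

theorem tutte:
  assumes "symp A" "finite W" "\<And>S. S \<subseteq> W \<Longrightarrow> odd_comps A (W - S) \<le> card S"
  shows "\<exists>m. perfect_matching A W m"
  using assms(2,3)
proof (induction "card W" arbitrary: W rule: less_induct)
  case (less W)
  note sym = assms(1) and fin = less.prems(1) and T = less.prems(2)
  define tight where "tight S \<longleftrightarrow> S \<subseteq> W \<and> odd_comps A (W - S) = card S" for S
  have "tight {}" using T[of "{}"] by (simp add: tight_def)
  have tight_bound: "\<forall>S. tight S \<longrightarrow> card S < Suc (card W)"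
    using fin by (auto simp: tight_def card_mono less_Suc_eq_le)
  obtain S where S: "tight S" and max: "\<And>S'. tight S' \<Longrightarrow> card S' \<le> card S"
    using ex_has_greatest_nat[OF \<open>tight {}\<close> tight_bound] by blast
  have SW: "S \<subseteq> W" and oS: "odd_comps A (W - S) = card S" using S by (auto simp: tight_def)
  have finS: "finite S" and finWS: "finite (W - S)" using SW fin finite_subset by auto
  let ?\<C> = "conn_comps A (W - S)"
  have \<C>: "C \<subseteq> W - S" "finite C" "C \<noteq> {}" if "C \<in> ?\<C>" for C
    using that conn_comps_subset[OF that] conn_comps_nonempty[OF that] finite_subset[OF _ finWS] by auto
  \<comment> \<open>Enlarging S inside a single component C cannot give another tight set, so
    Tutte's inequality is strict for S \<union> X.\<close>
  have enlarge: "odd_comps A (W - S - C) + odd_comps A (C - X) < card S + card X"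
    if C: "C \<in> ?\<C>" and X: "X \<subseteq> C" "X \<noteq> {}" for C X
  proof -
    have XW: "S \<union> X \<subseteq> W" using SW \<C>(1)[OF C] X by blast
    have "finite X" using X \<C>(2)[OF C] finite_subset by blast
    have "card (S \<union> X) = card S + card X"
      using X \<C>(1)[OF C] finS \<open>finite X\<close> by (intro card_Un_disjoint) auto
    moreover have "card X > 0" using \<open>finite X\<close> X(2) by (simp add: card_gt_0_iff)
    ultimately have "\<not> tight (S \<union> X)" using max[of "S \<union> X"] by auto
    then have "odd_comps A (W - (S \<union> X)) < card (S \<union> X)"
      using T[OF XW] XW by (simp add: tight_def)
    moreover have "W - (S \<union> X) = (W - S) - C \<union> (C - X)" using \<C>(1)[OF C] X by blast
    ultimately show ?thesis
      using odd_comps_split[OF sym finWS C, of "C - X"] \<open>card (S \<union> X) = _\<close> by auto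
  qed
  have split: "card S = odd_comps A (W - S - C) + (if odd (card C) then 1 else 0)" if C: "C \<in> ?\<C>" for C
  proof -
    have eq: "W - S - C \<union> C = W - S" using \<C>(1)[OF C] by blast
    show ?thesis
      using odd_comps_split[OF sym finWS C order_refl] unfolding eq oS odd_comps_conn_comp[OF sym C] .
  qed
  have oddC: "odd (card C)" if C: "C \<in> ?\<C>" for C
  proof (rule ccontr)
    assume ev: "\<not> odd (card C)"
    obtain v where v: "v \<in> C" using \<C>(3)[OF C] by blast
    have "card C = Suc (card (C - {v}))" by (rule card.remove[OF \<C>(2)[OF C] v])
    then have "odd (odd_comps A (C - {v}))" using ev odd_comps_parity[OF sym, of "C - {v}"] \<C>(2)[OF C] by simp
    then have "odd_comps A (C - {v}) \<ge> 1" using odd_pos by fastforce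
    then show False using enlarge[OF C, of "{v}"] split[OF C] ev v by simp
  qed
  have card\<C>: "card ?\<C> = card S"
  proof -
    have "{C \<in> ?\<C>. odd (card C)} = ?\<C>" using oddC by blast
    then show ?thesis using oS by (simp add: odd_comps_def)
  qed
  have IH: "\<exists>m. perfect_matching A (C - {v}) m" if C: "C \<in> ?\<C>" and v: "v \<in> C" for C v
  proof (rule less.hyps)
    have "C - {v} \<subset> W" using \<C>(1)[OF C] v by blast
    then show "card (C - {v}) < card W" using fin by (rule psubset_card_mono[rotated])
    show "finite (C - {v})" using \<C>(2)[OF C] by simp
    \<comment> \<open>For a violating X, maximality of S leaves card X + 1 as the only possible
      number of odd components, and parity rules it out because card C is odd.\<close>
    show "odd_comps A (C - {v} - X) \<le> card X" if X: "X \<subseteq> C - {v}" for X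
    proof (rule ccontr)
      assume gt: "\<not> odd_comps A (C - {v} - X) \<le> card X"
      have fX: "finite X" using X \<C>(2)[OF C] finite_subset by auto
      have "card (insert v X) = Suc (card X)" using X fX by (subst card_insert_disjoint) auto
      moreover have "card C = card (C - insert v X) + card (insert v X)"
      proof -
        have "insert v X \<subseteq> C" using X v by blast
        then show ?thesis using \<C>(2)[OF C] fX by (simp add: card_Diff_subset card_mono del: card_insert_disjoint card_Diff_insert)
      qed
      moreover have eq: "C - {v} - X = C - insert v X" by blast
      ultimately have "even (odd_comps A (C - insert v X)) \<longleftrightarrow> even (card X)"
        using oddC[OF C] odd_comps_parity[OF sym, of "C - insert v X"] \<C>(2)[OF C] by simp
      moreover have "odd_comps A (W - S - C) + odd_comps A (C - insert v X) < card S + Suc (card X)"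
        using enlarge[OF C, of "insert v X"] X v \<open>card (insert v X) = _\<close> by auto
      moreover have "card S = Suc (odd_comps A (W - S - C))" using split[OF C] oddC[OF C] by simp
      moreover have "card X < odd_comps A (C - insert v X)" using gt unfolding eq by simp
      ultimately have "odd_comps A (C - insert v X) = Suc (card X)"
        and "even (odd_comps A (C - insert v X)) = even (card X)" by linarith+
      then show False by simp
    qed
  qed
  define N where "N C = {s \<in> S. \<exists>v\<in>C. A v s}" for C
  have "\<exists>f. inj_on f ?\<C> \<and> (\<forall>C\<in>?\<C>. f C \<in> N C)"
  proof (rule hall_marriage)
    show "finite ?\<C>" by (rule finite_conn_comps[OF finWS])
    show "finite (N C)" for C using finS by (simp add: N_def)
    fix \<B> assume \<B>: "\<B> \<subseteq> ?\<C>"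
    let ?N = "\<Union>(N ` \<B>)"
    have NS: "?N \<subseteq> S" by (auto simp: N_def)
    \<comment> \<open>Deleting only the neighbours in S of the chosen components keeps each of them
      a component, so Tutte's condition for this smaller set is exactly Hall's condition.\<close>
    have "C \<in> conn_comps A (W - ?N)" if "C \<in> \<B>" for C
    proof -
      have C: "C \<in> ?\<C>" using that \<B> by blast
      have sub: "C \<subseteq> W - ?N" using \<C>(1)[OF C] NS by blast
      have no: "\<not> A x y" if "x \<in> C" "y \<in> W - ?N - C" for x y
      proof
        assume "A x y"
        show False
        proof (cases "y \<in> S")
          case True
          then show False using \<open>A x y\<close> that \<open>C \<in> \<B>\<close> by (auto simp: N_def)
        next
          case False
          then show False using conn_comps_closed[OF C, of x y] \<open>A x y\<close> that by blast
        qed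
      qed
      have "conn_comps A (C \<union> (W - ?N - C)) = conn_comps A C \<union> conn_comps A (W - ?N - C)"
        by (rule conn_comps_Un[OF sym no])
      moreover have "C \<union> (W - ?N - C) = W - ?N" using sub by blast
      ultimately show ?thesis using conn_comps_of_conn_comp[OF sym C] by auto
    qed
    then have "\<B> \<subseteq> {C \<in> conn_comps A (W - ?N). odd (card C)}" using oddC \<B> by blast
    then have "card \<B> \<le> odd_comps A (W - ?N)" unfolding odd_comps_def
      by (rule card_mono[rotated]) (use finite_conn_comps[of "W - ?N" A] fin in auto)
    also have "\<dots> \<le> card ?N" using T[of ?N] NS SW by blast
    finally show "card \<B> \<le> card ?N" .
  qed
  then obtain f where f: "inj_on f ?\<C>" "\<And>C. C \<in> ?\<C> \<Longrightarrow> f C \<in> N C" by blast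
  have "f ` ?\<C> = S"
    using f card\<C> finS by (intro card_subset_eq) (auto simp: card_image N_def)
  define g where "g = the_inv_into ?\<C> f"
  have g: "g s \<in> ?\<C>" "f (g s) = s" if "s \<in> S" for s
    using the_inv_into_into[OF f(1), of s ?\<C>] f_the_inv_into_f[OF f(1)] that \<open>f ` ?\<C> = S\<close>
    unfolding g_def by auto
  have gf: "g (f C) = C" if "C \<in> ?\<C>" for C using the_inv_into_f_f[OF f(1) that] by (simp add: g_def)
  define w where "w C = (SOME v. v \<in> C \<and> A v (f C))" for C
  have w: "w C \<in> C" "A (w C) (f C)" "f C \<in> S" if "C \<in> ?\<C>" for C
  proof -
    have "\<exists>v. v \<in> C \<and> A v (f C)" "f C \<in> S" using f(2)[OF that] by (auto simp: N_def)
    then show "w C \<in> C" "A (w C) (f C)" "f C \<in> S"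
      using someI_ex[of "\<lambda>v. v \<in> C \<and> A v (f C)"] unfolding w_def by auto
  qed
  define p where "p C = (SOME m. perfect_matching A (C - {w C}) m)" for C
  have p: "perfect_matching A (C - {w C}) (p C)" if "C \<in> ?\<C>" for C
    unfolding p_def by (rule someI_ex[OF IH[OF that w(1)[OF that]]])
  define m where "m x = (if x \<in> S then w (g x) else
     let C = conn_comp A (W - S) x in if x = w C then f C else p C x)" for x
  have cc: "conn_comp A (W - S) x = C" if "C \<in> ?\<C>" "x \<in> C" for C x
    using conn_comps_disjoint[OF sym that(1) _ that(2) conn_comp_self[of x A "W - S"]] that \<C>(1)[OF that(1)]
    by (auto simp: conn_comps_def)
  have mC: "m x = (if x = w C then f C else p C x)" if "C \<in> ?\<C>" "x \<in> C" for C x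
    using cc[OF that] \<C>(1)[OF that(1)] that(2) unfolding m_def Let_def by auto
  have mS: "m s = w (g s)" if "s \<in> S" for s using that by (simp add: m_def)
  have "m x \<in> W \<and> m (m x) = x \<and> A x (m x)" if x: "x \<in> W" for x
  proof (cases "x \<in> S")
    case True
    have G: "g x \<in> ?\<C>" using g True by blast
    then have "w (g x) \<in> g x" by (rule w)
    then have "m (w (g x)) = f (g x)" using mC[OF G] by simp
    then show ?thesis using mS[OF True] g(2)[OF True] w[OF G] \<C>(1)[OF G] sympD[OF sym] by auto
  next
    case False
    define C where "C = conn_comp A (W - S) x"
    have C: "C \<in> ?\<C>" and xC: "x \<in> C" using x False conn_comp_self by (auto simp: C_def conn_comps_def)
    show ?thesis
    proof (cases "x = w C")
      case True
      then have "m x = f C" using mC[OF C xC] by simp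
      moreover have "m (f C) = w C" using mS[OF w(3)[OF C]] gf[OF C] by simp
      ultimately show ?thesis using True w[OF C] SW by auto
    next
      case ne: False
      then have mx: "m x = p C x" using mC[OF C xC] by simp
      have P: "p C x \<in> C - {w C}" "p C (p C x) = x" "A x (p C x)"
        using p[OF C] xC ne by (auto simp: perfect_matching_def)
      then have "m (p C x) = p C (p C x)" using mC[OF C, of "p C x"] by auto
      then show ?thesis using mx P \<C>(1)[OF C] by auto
    qed
  qed
  then show ?case unfolding perfect_matching_def by blast
qed

section \<open>Blow-ups and barriers\<close>

text \<open>The vertex set of the blow-up: b v copies of each v. Under \<open>lift_rel\<close> two
  copies of one vertex are twins, and nonadjacent when A is irreflexive.\<close>

definition fibers :: "'a set \<Rightarrow> ('a \<Rightarrow> nat) \<Rightarrow> ('a \<times> nat) set" where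
  "fibers W b = Sigma W (\<lambda>v. {..<b v})"

definition lift_rel :: "('a \<Rightarrow> 'a \<Rightarrow> bool) \<Rightarrow> 'a \<times> nat \<Rightarrow> 'a \<times> nat \<Rightarrow> bool" where
  "lift_rel A p q \<longleftrightarrow> A (fst p) (fst q)"

definition isolated :: "('a \<Rightarrow> 'a \<Rightarrow> bool) \<Rightarrow> 'a set \<Rightarrow> 'a set" where
  "isolated A W = {v \<in> W. \<forall>w\<in>W. \<not> A v w}"

lemma card_fibers: "finite W \<Longrightarrow> card (fibers W b) = sum b W"
  by (simp add: fibers_def)

lemma finite_fibers: "finite W \<Longrightarrow> finite (fibers W b)"
  by (simp add: fibers_def)

lemma symp_lift_rel: "symp A \<Longrightarrow> symp (lift_rel A)"
  by (simp add: symp_def lift_rel_def)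

lemma conn_comp_isolated:
  assumes "x \<in> isolated A W" shows "conn_comp A W x = {x}"
proof -
  have "y = x" if "(x, y) \<in> {(x, y). x \<in> W \<and> y \<in> W \<and> A x y}\<^sup>*" for y
    using that assms by (induction) (auto simp: isolated_def)
  then show ?thesis using conn_comp_self[of x A W] by (auto simp: conn_comp_def reach_def)
qed

text \<open>Copies of the same vertex are joined through a copy of a neighbour, which exists because
  x is not isolated and every b v is positive. For isolated x the copies fall apart into
  singletons.\<close>

lemma conn_comp_fibers:
  assumes "symp A" "\<And>v. v \<in> W \<Longrightarrow> 1 \<le> b v" "x \<in> W" "x \<notin> isolated A W" "i < b x"
  shows "conn_comp (lift_rel A) (fibers W b) (x, i) = fibers (conn_comp A W x) b"
proof
  let ?C = "conn_comp (lift_rel A) (fibers W b) (x, i)"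
  have xi: "(x, i) \<in> fibers W b" using assms by (simp add: fibers_def)
  show "?C \<subseteq> fibers (conn_comp A W x) b"
  proof
    fix q assume q: "q \<in> ?C"
    then have "((x, i), q) \<in> {(p, q). p \<in> fibers W b \<and> q \<in> fibers W b \<and> lift_rel A p q}\<^sup>*"
      by (simp add: conn_comp_def reach_def)
    then have "fst q \<in> conn_comp A W x"
    proof induction
      case base then show ?case by (simp add: conn_comp_self)
    next
      case (step p q)
      then show ?case using conn_comp_step[OF step(3), of "fst q"] by (auto simp: fibers_def lift_rel_def)
    qed
    moreover have "q \<in> fibers W b" using conn_comp_subset[OF xi] q by blast
    ultimately show "q \<in> fibers (conn_comp A W x) b" by (auto simp: fibers_def)
  qed
  have st: "q \<in> ?C" if "p \<in> ?C" "q \<in> fibers W b" "A (fst p) (fst q)" for p q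
    using conn_comp_step[OF that(1) _ that(2)] conn_comp_subset[OF xi] that by (auto simp: lift_rel_def)
  have "\<forall>j<b y. (y, j) \<in> ?C" if "(x, y) \<in> {(x, y). x \<in> W \<and> y \<in> W \<and> A x y}\<^sup>*" for y
    using that
  proof induction
    case base
    obtain z where z: "z \<in> W" "A x z" using assms(3,4) by (auto simp: isolated_def)
    have "(z, 0) \<in> ?C"
      using st[OF conn_comp_self, of "(z, 0)"] z assms(2)[of z] by (auto simp: fibers_def)
    then show ?case using st[of "(z, 0)"] z assms(3) sympD[OF assms(1) z(2)] by (auto simp: fibers_def)
  next
    case (step y z)
    then have "(y, 0) \<in> ?C" using assms(2)[of y] by auto
    then show ?case using st[of "(y, 0)"] step(2) by (auto simp: fibers_def)
  qed
  then show "fibers (conn_comp A W x) b \<subseteq> ?C"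
    by (auto simp: fibers_def conn_comp_def reach_def)
qed

text \<open>An isolated vertex contributes b v \<le> k singleton components; any other component C
  blows up to a single component of order \<open>sum b C\<close>.\<close>

lemma odd_comps_fibers_le:
  assumes "symp A" "irreflp A" "finite W" "\<And>v. v \<in> W \<Longrightarrow> 1 \<le> b v \<and> b v \<le> k"
  shows "odd_comps (lift_rel A) (fibers W b) \<le>
    k * card (isolated A W) + card {C \<in> conn_comps A W. 2 \<le> card C \<and> odd (sum b C)}"
proof -
  let ?Q = "{C \<in> conn_comps A W. 2 \<le> card C \<and> odd (sum b C)}" and ?I = "isolated A W"
  have fI: "finite ?I" using assms(3) by (simp add: isolated_def)
  have "{C \<in> conn_comps (lift_rel A) (fibers W b). odd (card C)}
      \<subseteq> (\<lambda>p. {p}) ` fibers ?I b \<union> (\<lambda>C. fibers C b) ` ?Q"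
  proof
    fix C assume C: "C \<in> {C \<in> conn_comps (lift_rel A) (fibers W b). odd (card C)}"
    then obtain x i where x: "x \<in> W" "i < b x" and Ceq: "C = conn_comp (lift_rel A) (fibers W b) (x, i)"
      by (auto simp: conn_comps_def fibers_def)
    show "C \<in> (\<lambda>p. {p}) ` fibers ?I b \<union> (\<lambda>C. fibers C b) ` ?Q"
    proof (cases "x \<in> ?I")
      case True
      then have "(x, i) \<in> isolated (lift_rel A) (fibers W b)"
        using x by (auto simp: isolated_def fibers_def lift_rel_def)
      then have "C = {(x, i)}" using Ceq conn_comp_isolated by metis
      then show ?thesis using True x by (auto simp: fibers_def)
    next
      case False
      let ?D = "conn_comp A W x"
      have CD: "C = fibers ?D b"
        unfolding Ceq using conn_comp_fibers[of A W b x i] assms x False by blast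
      have D: "?D \<in> conn_comps A W" using x by (simp add: conn_comps_def)
      have fD: "finite ?D" using conn_comp_subset[OF x(1)] assms(3) by (rule finite_subset)
      obtain z where z: "z \<in> W" "A x z" using False x by (auto simp: isolated_def)
      then have "{x, z} \<subseteq> ?D" using conn_comp_self conn_comp_step[of x A W x z] x by fast
      moreover have "x \<noteq> z" using z assms(2) by (metis irreflpD)
      ultimately have "2 \<le> card ?D" using card_mono[OF fD, of "{x, z}"] by simp
      moreover have "odd (sum b ?D)" using C CD card_fibers[OF fD] by simp
      ultimately show ?thesis using CD D by blast
    qed
  qed
  then have "odd_comps (lift_rel A) (fibers W b) \<le> card ((\<lambda>p. {p}) ` fibers ?I b \<union> (\<lambda>C. fibers C b) ` ?Q)"
    unfolding odd_comps_def
    by (rule card_mono[rotated]) (use finite_fibers[OF fI] finite_conn_comps[OF assms(3)] in auto)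
  also have "\<dots> \<le> card ((\<lambda>p. {p}) ` fibers ?I b) + card ((\<lambda>C. fibers C b) ` ?Q)" by (rule card_Un_le)
  also have "\<dots> \<le> card (fibers ?I b) + card ?Q"
    using finite_fibers[OF fI] finite_conn_comps[OF assms(3), of A] by (intro add_mono card_image_le) auto
  also have "card (fibers ?I b) \<le> k * card ?I"
    using card_fibers[OF fI] sum_bounded_above[of ?I b k] assms(4) by (auto simp: isolated_def mult.commute)
  finally show ?thesis by simp
qed

text \<open>Tutte's theorem gives a barrier among the copies; one of least cardinality comes from a
  vertex set of the original graph. Evenness of the total demand raises its excess from one to
  two.\<close>

lemma fibers_barrier:
  assumes "symp A" "finite V" "\<And>v. v \<in> V \<Longrightarrow> 1 \<le> b v"
    and "even (sum b V)" "\<nexists>m. perfect_matching (lift_rel A) (fibers V b) m"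
  obtains S where "S \<subseteq> V" "sum b S + 2 \<le> odd_comps (lift_rel A) (fibers (V - S) b)"
proof -
  let ?A = "lift_rel A" and ?V = "fibers V b"
  have sym: "symp ?A" by (rule symp_lift_rel[OF assms(1)])
  have fin: "finite ?V" by (rule finite_fibers[OF assms(2)])
  define viol where "viol S \<longleftrightarrow> S \<subseteq> ?V \<and> card S < odd_comps ?A (?V - S)" for S
  have "\<exists>S. viol S"
  proof (rule ccontr)
    assume "\<nexists>S. viol S"
    then have "\<And>S. S \<subseteq> ?V \<Longrightarrow> odd_comps ?A (?V - S) \<le> card S" by (auto simp: viol_def not_less)
    then show False using tutte[OF sym fin] assms(5) by blast
  qed
  then obtain S' where S': "viol S'" and min: "\<And>T. viol T \<Longrightarrow> card S' \<le> card T"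
    using arg_min_natI[of viol _ card] arg_min_nat_le[of viol _ card] by blast
  have SV: "S' \<subseteq> ?V" and lt: "card S' < odd_comps ?A (?V - S')" using S' by (auto simp: viol_def)
  have finS: "finite S'" using SV fin finite_subset by blast
  \<comment> \<open>A minimal violating set is a union of fibers: a vertex x in it whose twin y is outside can be
    moved out, since all its new neighbours lie in the component of y.\<close>
  have full: "(v, j) \<in> S'" if vi: "(v, i) \<in> S'" and vj: "j < b v" for v i j
  proof (rule ccontr)
    let ?x = "(v, i)" and ?y = "(v, j)" and ?W = "?V - S'"
    assume y: "?y \<notin> S'"
    have yW: "?y \<in> ?W" using y vi vj SV by (auto simp: fibers_def)
    have finW: "finite ?W" using fin by simp
    define C where "C = conn_comp ?A ?W ?y"
    have C: "C \<in> conn_comps ?A ?W" using yW by (auto simp: C_def conn_comps_def)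
    have CW: "C \<subseteq> ?W" by (rule conn_comps_subset[OF C])
    have "odd_comps ?A (?W - C \<union> insert ?x C) = odd_comps ?A (?W - C) + odd_comps ?A (insert ?x C)"
    proof (rule odd_comps_Un[OF sym])
      show "finite (?W - C)" "finite (insert ?x C)" using finW finite_subset[OF CW] by auto
      show "(?W - C) \<inter> insert ?x C = {}" using vi by auto
      show "\<not> ?A p q" if p: "p \<in> ?W - C" and q: "q \<in> insert ?x C" for p q
      proof
        assume "?A p q"
        then have qp: "?A q p" by (rule sympD[OF sym])
        then have "?A (if q = ?x then ?y else q) p" by (auto simp: lift_rel_def)
        moreover have "(if q = ?x then ?y else q) \<in> C" using q conn_comp_self[of ?y] by (auto simp: C_def)
        ultimately have "p \<in> C" using conn_comps_closed[OF C] p by blast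
        then show False using p by blast
      qed
    qed
    moreover have "odd_comps ?A (?W - C \<union> C) = odd_comps ?A (?W - C) + odd_comps ?A C"
      by (rule odd_comps_split[OF sym finW C order_refl])
    moreover have "odd_comps ?A C \<le> 1" using odd_comps_conn_comp[OF sym C] by simp
    moreover have "?W - C \<union> C = ?W" "?W - C \<union> insert ?x C = ?V - (S' - {?x})" using CW vi SV by auto
    ultimately have "odd_comps ?A ?W \<le> odd_comps ?A (?V - (S' - {?x})) + 1" by simp
    moreover have "card S' = Suc (card (S' - {?x}))" by (rule card.remove[OF finS vi])
    ultimately have "viol (S' - {?x})" using lt SV by (auto simp: viol_def)
    then show False using min \<open>card S' = Suc (card (S' - {?x}))\<close> by fastforce
  qed
  define S where "S = fst ` S'"
  have S: "S \<subseteq> V" using SV by (auto simp: S_def fibers_def)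
  have S'eq: "S' = fibers S b"
  proof
    show "S' \<subseteq> fibers S b" using SV by (force simp: S_def fibers_def)
    show "fibers S b \<subseteq> S'" using full by (auto simp: S_def fibers_def)
  qed
  have W: "?V - S' = fibers (V - S) b" by (auto simp: S'eq fibers_def)
  have cS: "card S' = sum b S" unfolding S'eq by (rule card_fibers) (use S assms(2) finite_subset in auto)
  have "card ?V = card (?V - S') + card S'"
    using SV fin finS by (simp add: card_Diff_subset card_mono)
  then have "even (card (?V - S')) \<longleftrightarrow> even (card S')" using assms(2,4) card_fibers[of V b] by simp
  then have "even (odd_comps ?A (?V - S')) \<longleftrightarrow> even (card S')"
    using odd_comps_parity[OF sym, of "?V - S'"] fin by simp
  \<comment> \<open>The number of odd components and \<open>card S'\<close> have equal parity, so an
    excess of exactly one is impossible.\<close>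
  then have "odd_comps ?A (?V - S') \<noteq> Suc (card S')" by auto
  then have "card S' + 2 \<le> odd_comps ?A (?V - S')" using lt by linarith
  then show thesis using that S cS W by metis
qed

section \<open>From perfect matchings of the blow-up to edge weights, and from noncritical graphs to
  barriers\<close>

lemma simple_graph_edge:
  "simple_graph V E \<Longrightarrow> e \<in> E \<Longrightarrow> \<exists>u v. e = {u, v} \<and> u \<noteq> v \<and> u \<in> V \<and> v \<in> V"
  by (simp add: simple_graph_def)

lemma finite_edges:
  assumes "simple_graph V E" shows "finite E"
proof (rule finite_subset)
  show "E \<subseteq> Pow V"
  proof
    fix e assume "e \<in> E"
    then obtain u v where "e = {u, v}" "u \<in> V" "v \<in> V" using simple_graph_edge[OF assms] by metis
    then show "e \<in> Pow V" by simp
  qed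
  show "finite (Pow V)" using assms by (simp add: simple_graph_def)
qed

text \<open>The weight of e is the number of matched pairs lying over e. No pair lies inside a
  fiber, so the b v copies of v belong to b v distinct pairs, and these are the pairs counted on the
  edges at v.\<close>

lemma perfect_matching_hdeg:
  assumes "simple_graph V E" "perfect_matching (lift_rel (adj E)) (fibers V b) m"
  obtains h where "\<And>v. v \<in> V \<Longrightarrow> hdeg E h v = b v"
proof -
  let ?V = "fibers V b"
  have finV: "finite V" using assms(1) by (simp add: simple_graph_def)
  note E2 = simple_graph_edge[OF assms(1)] and finE = finite_edges[OF assms(1)]
  have m: "m p \<in> ?V" "m (m p) = p" "{fst p, fst (m p)} \<in> E" if "p \<in> ?V" for p
    using assms(2) that by (auto simp: perfect_matching_def lift_rel_def adj_def)
  have neq: "fst p \<noteq> fst (m p)" if p: "p \<in> ?V" for p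
  proof -
    obtain u v where "{fst p, fst (m p)} = {u, v}" "u \<noteq> v" using E2[OF m(3)[OF p]] by blast
    then show ?thesis by (metis doubleton_eq_iff)
  qed
  define M where "M = (\<lambda>p. {p, m p}) ` ?V"
  have finM: "finite M" using finite_fibers[OF finV] by (simp add: M_def)
  define h where "h e = card {P \<in> M. fst ` P = e}" for e
  have "hdeg E h v = b v" if v: "v \<in> V" for v
  proof -
    let ?E = "{e \<in> E. v \<in> e}"
    have "hdeg E h v = card (\<Union>e\<in>?E. {P \<in> M. fst ` P = e})"
      unfolding hdeg_def h_def using finE finM by (subst card_UN_disjoint) auto
    also have "(\<Union>e\<in>?E. {P \<in> M. fst ` P = e}) = (\<lambda>p. {p, m p}) ` ({v} \<times> {..<b v})"
    proof (rule set_eqI)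
      fix P
      have "P \<in> (\<Union>e\<in>?E. {P \<in> M. fst ` P = e}) \<longleftrightarrow> P \<in> M \<and> v \<in> fst ` P"
        using m(3) by (auto simp: M_def)
      also have "\<dots> \<longleftrightarrow> P \<in> (\<lambda>p. {p, m p}) ` ({v} \<times> {..<b v})"
      proof
        assume P: "P \<in> M \<and> v \<in> fst ` P"
        then obtain p where p: "p \<in> ?V" "P = {p, m p}" by (auto simp: M_def)
        define q where "q = (if fst p = v then p else m p)"
        have q: "q \<in> ?V" "P = {q, m q}" "fst q = v"
          using P p m(1,2)[OF p(1)] by (auto simp: q_def)
        then have "q \<in> {v} \<times> {..<b v}" by (auto simp: fibers_def)
        then show "P \<in> (\<lambda>p. {p, m p}) ` ({v} \<times> {..<b v})" using q by blast
      next
        assume "P \<in> (\<lambda>p. {p, m p}) ` ({v} \<times> {..<b v})"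
        then show "P \<in> M \<and> v \<in> fst ` P" using v by (auto simp: M_def fibers_def)
      qed
      finally show "P \<in> (\<Union>e\<in>?E. {P \<in> M. fst ` P = e}) \<longleftrightarrow> P \<in> (\<lambda>p. {p, m p}) ` ({v} \<times> {..<b v})" .
    qed
    also have "card \<dots> = card ({v} \<times> {..<b v})"
    proof (rule card_image, rule inj_onI)
      fix p q assume p: "p \<in> {v} \<times> {..<b v}" and q: "q \<in> {v} \<times> {..<b v}" and eq: "{p, m p} = {q, m q}"
      have "p \<in> ?V" using p v by (auto simp: fibers_def)
      then have "fst q \<noteq> fst (m p)" using neq[of p] p q by auto
      then show "p = q" using eq by (metis doubleton_eq_iff)
    qed
    finally show ?thesis by simp
  qed
  then show thesis using that by blast
qed

lemma connected_graph_reach: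
  assumes "connected_graph V E" "u \<in> V" "w \<in> V"
  shows "(u, w) \<in> reach (adj E) V"
proof -
  have "(hd xs, last xs) \<in> {(x, y). x \<in> V \<and> y \<in> V \<and> adj E x y}\<^sup>*"
    if "xs \<noteq> []" "set xs \<subseteq> V" "successively (adj E) xs" for xs
    using that
  proof (induction xs rule: induct_list012)
    case (3 x y zs)
    then show ?case by (auto intro: converse_rtrancl_into_rtrancl)
  qed auto
  moreover obtain xs where "xs \<noteq> []" "set xs \<subseteq> V" "successively (adj E) xs" "hd xs = u" "last xs = w"
    using assms unfolding connected_graph_def is_walk_def by blast
  ultimately show ?thesis unfolding reach_def by blast
qed

lemma symp_adj: "symp (adj E)"
  by (simp add: symp_def adj_def insert_commute)

lemma irreflp_adj: "simple_graph V E \<Longrightarrow> irreflp (adj E)"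
  unfolding simple_graph_def adj_def irreflp_def by (auto simp: doubleton_eq_iff)

text \<open>With demands k - d at v and k elsewhere, the barrier inequality reads: demand of S plus
  2 is at most k times the number of isolated vertices plus the number of odd components of order at
  least two. If S exceeds the isolated vertices by t + 1, the k(t + 1) units missing must come from
  components, and k \<ge> 3 yields at least 3(t + 1) of order at least three.\<close>

lemma noncritical_barrier:
  assumes G: "simple_graph V E" "connected_graph V E" "2 \<le> card V"
    and k: "odd k" "3 \<le> k" "1 \<le> d" "d < k" "card V mod 2 = d mod 2"
    and nc: "\<not> k_d_critical V E k d"
  obtains S where "S \<subseteq> V" "S \<noteq> {}"
    "card S \<le> card (isolated (adj E) (V - S)) \<or>
      3 * card S \<le> 3 * card (isolated (adj E) (V - S)) + card {C \<in> conn_comps (adj E) (V - S). 3 \<le> card C}"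
proof -
  let ?A = "adj E"
  have fin: "finite V" using G(1) by (simp add: simple_graph_def)
  obtain v where v: "v \<in> V" and noh: "\<And>h. k_matching V E k h \<Longrightarrow> hdeg E h v = k - d \<Longrightarrow>
      \<exists>u\<in>V - {v}. hdeg E h u \<noteq> k"
    using nc unfolding k_d_critical_def by blast
  define b where "b u = (if u = v then k - d else k)" for u
  have b: "1 \<le> b u \<and> b u \<le> k" for u using k by (auto simp: b_def)
  \<comment> \<open>The deduction of d is written as an addition on the left because natural-number
    subtraction would truncate.\<close>
  have sumb: "sum b X + (if v \<in> X then d else 0) = k * card X" if "finite X" for X
    using that
  proof (induction X)
    case (insert x X)
    then show ?case using k(4) by (auto simp: b_def split: if_splits)
  qed simp
  have "even (sum b V)"
  proof -
    have "even (sum b V + d) \<longleftrightarrow> even (card V)" using sumb[OF fin] v k(1) by simp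
    moreover have "even (card V) \<longleftrightarrow> even d" using k(5) by (metis even_iff_mod_2_eq_zero)
    ultimately show ?thesis by (cases "even d") simp_all
  qed
  moreover have "\<nexists>m. perfect_matching (lift_rel ?A) (fibers V b) m"
  proof
    assume "\<exists>m. perfect_matching (lift_rel ?A) (fibers V b) m"
    then obtain h where h: "\<And>v. v \<in> V \<Longrightarrow> hdeg E h v = b v"
      using perfect_matching_hdeg[OF G(1)] by metis
    have "h e \<le> k" if e: "e \<in> E" for e
    proof -
      obtain u where u: "u \<in> e" "u \<in> V" using simple_graph_edge[OF G(1) e] by blast
      have "h e \<le> hdeg E h u" unfolding hdeg_def using e u finite_edges[OF G(1)] by (intro member_le_sum) auto
      then show ?thesis using h[OF u(2)] b[of u] by simp
    qed
    then have "k_matching V E k h" using h b by (simp add: k_matching_def)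
    then show False using noh[of h] h v by (auto simp: b_def)
  qed
  ultimately obtain S where S: "S \<subseteq> V" "sum b S + 2 \<le> odd_comps (lift_rel ?A) (fibers (V - S) b)"
    using fibers_barrier[OF symp_adj fin] b by metis
  let ?I = "isolated ?A (V - S)" and ?Q = "{C \<in> conn_comps ?A (V - S). 2 \<le> card C \<and> odd (sum b C)}"
    and ?Q3 = "{C \<in> conn_comps ?A (V - S). 3 \<le> card C}"
  have le: "sum b S + 2 \<le> k * card ?I + card ?Q"
    using S(2) odd_comps_fibers_le[OF symp_adj irreflp_adj[OF G(1)], of "V - S" b k] fin b by simp
  have finS: "finite S" using S(1) fin finite_subset by blast
  have finC: "finite (conn_comps ?A (V - S))" using fin by (simp add: finite_conn_comps)
  \<comment> \<open>An empty barrier would require two odd components, whereas the connected graph G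
    has only one component and no isolated vertex.\<close>
  have "S \<noteq> {}"
  proof
    assume "S = {}"
    have "?I = {}"
    proof (rule equals0I)
      fix x assume x: "x \<in> ?I"
      then have "conn_comp ?A V x = {x}" using conn_comp_isolated \<open>S = {}\<close> by (metis Diff_empty)
      moreover have "V \<subseteq> conn_comp ?A V x"
        using connected_graph_reach[OF G(2)] x by (auto simp: conn_comp_def isolated_def)
      ultimately have "card V \<le> 1" using card_mono[of "{x}" V] by simp
      then show False using G(3) by simp
    qed
    moreover have "conn_comps ?A V \<subseteq> {V}"
      using connected_graph_reach[OF G(2)] conn_comp_subset[of _ V ?A]
      by (auto simp: conn_comps_def conn_comp_def)
    then have "?Q \<subseteq> {V}" using \<open>S = {}\<close> by auto
    then have "card ?Q \<le> 1" using card_mono[of "{V}" ?Q] by simp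
    ultimately show False using le by simp
  qed
  \<comment> \<open>A component of odd total demand has odd order, hence at least 3 vertices, unless it contains v.\<close>
  have Q3: "C \<in> ?Q3" if C: "C \<in> ?Q" "v \<notin> C" for C
  proof -
    have "finite C" using C(1) fin conn_comps_subset finite_subset by (metis (lifting) finite_Diff mem_Collect_eq)
    then have "odd (card C)" using sumb[of C] C by auto
    then have "card C \<noteq> 2" by auto
    then show ?thesis using C by auto
  qed
  have "card S \<le> card ?I \<or> 3 * card S \<le> 3 * card ?I + card ?Q3"
  proof (rule disjCI)
    assume "\<not> 3 * card S \<le> 3 * card ?I + card ?Q3"
    then have c3: "3 * card ?I + card ?Q3 < 3 * card S" by simp
    show "card S \<le> card ?I"
    proof (rule ccontr)
      assume "\<not> card S \<le> card ?I"
      then obtain t where t: "card S = card ?I + Suc t" using less_iff_Suc_add by (metis add_Suc_right not_le)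
      then have q3: "card ?Q3 < 3 * Suc t" using c3 by simp
      show False
      proof (cases "v \<in> S")
        case True
        then have "?Q \<subseteq> ?Q3" using Q3 conn_comps_subset by fast
        then have "card ?Q \<le> card ?Q3" using finC by (intro card_mono) auto
        moreover have "k * card S + 2 \<le> k * card ?I + card ?Q + d" using le sumb[OF finS] True by simp
        ultimately have "k * Suc t + 2 < 3 * Suc t + d" using q3 t by (simp add: algebra_simps)
        \<comment> \<open>The product of k and t is not linear; its worst case t = 0 suffices and
          brings the claim down to d < k.\<close>
        moreover have "(k - 3) * Suc t \<ge> k - 3" by simp
        then have "k * Suc t \<ge> 3 * Suc t + (k - 3)" using k(2) by (simp add: diff_mult_distrib)
        ultimately have "k + 2 < d + 3" using k(2) by linarith
        then show False using k(4) by simp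
      next
        case False
        \<comment> \<open>The component of v is the only one that can have odd demand and order two.
          It costs one unit, which the excess of two absorbs.\<close>
        define Cv where "Cv = conn_comp ?A (V - S) v"
        have "?Q - {Cv} \<subseteq> ?Q3"
        proof
          fix C assume C: "C \<in> ?Q - {Cv}"
          have "v \<notin> C"
          proof
            assume "v \<in> C"
            moreover have "Cv \<in> conn_comps ?A (V - S)" using v False by (auto simp: conn_comps_def Cv_def)
            ultimately have "C = Cv"
              using conn_comps_disjoint[OF symp_adj, of C E "V - S" Cv v] C conn_comp_self[of v ?A "V - S"]
              by (auto simp: Cv_def)
            then show False using C by blast
          qed
          then show "C \<in> ?Q3" using Q3 C by blast
        qed
        then have "card (?Q - {Cv}) \<le> card ?Q3" using finC by (intro card_mono) auto
        moreover have "card ?Q \<le> card (?Q - {Cv}) + 1"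
          using card_Diff1_le[of ?Q Cv] card_Diff_singleton_if[of ?Q Cv] by (auto split: if_splits)
        moreover have "k * card S + 2 \<le> k * card ?I + card ?Q" using le sumb[OF finS] False by simp
        ultimately have "k * Suc t + 2 < 3 * Suc t + 1" using q3 t by (simp add: algebra_simps)
        moreover have "3 * Suc t \<le> k * Suc t" using k(2) by (rule mult_right_mono) simp
        ultimately show False by linarith
      qed
    qed
  qed
  then show thesis using that S(1) \<open>S \<noteq> {}\<close> by blast
qed

section \<open>The largest eigenvalue of a symmetric matrix\<close>

definition quad :: "'a set \<Rightarrow> ('a \<Rightarrow> 'a \<Rightarrow> real) \<Rightarrow> ('a \<Rightarrow> real) \<Rightarrow> real" where
  "quad V D x = (\<Sum>u\<in>V. \<Sum>w\<in>V. D u w * (x u * x w))"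

definition sq_sum :: "'a set \<Rightarrow> ('a \<Rightarrow> real) \<Rightarrow> real" where
  "sq_sum V x = (\<Sum>u\<in>V. (x u)\<^sup>2)"

definition eigenpair :: "'a set \<Rightarrow> ('a \<Rightarrow> 'a \<Rightarrow> real) \<Rightarrow> real \<Rightarrow> ('a \<Rightarrow> real) \<Rightarrow> bool" where
  "eigenpair V D \<mu> x \<longleftrightarrow> (\<exists>u\<in>V. x u \<noteq> 0) \<and> (\<forall>u\<in>V. (\<Sum>w\<in>V. D u w * x w) = \<mu> * x u)"

lemma sq_sum_pos: "finite V \<Longrightarrow> u \<in> V \<Longrightarrow> x u \<noteq> 0 \<Longrightarrow> 0 < sq_sum V x"
  unfolding sq_sum_def by (rule sum_pos2[of V u]) auto

lemma quad_eigenpair: "eigenpair V D \<mu> x \<Longrightarrow> quad V D x = \<mu> * sq_sum V x"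
proof -
  assume "eigenpair V D \<mu> x"
  then have eq: "(\<Sum>w\<in>V. D u w * x w) = \<mu> * x u" if "u \<in> V" for u using that by (simp add: eigenpair_def)
  have "quad V D x = (\<Sum>u\<in>V. x u * (\<Sum>w\<in>V. D u w * x w))"
    unfolding quad_def by (simp add: sum_distrib_left mult_ac)
  also have "\<dots> = (\<Sum>u\<in>V. \<mu> * (x u)\<^sup>2)" using eq by (intro sum.cong) (auto simp: power2_eq_square)
  finally show ?thesis by (simp add: sq_sum_def sum_distrib_left)
qed

text \<open>Vectors are functions on the whole type, so compactness of the unit sphere is taken in
  the product topology; homogeneity then extends the bound from unit vectors to all y.\<close>

lemma max_rayleigh:
  assumes "finite V" "V \<noteq> {}"
  obtains x where "sq_sum V x = 1" "\<And>y. quad V D y \<le> quad V D x * sq_sum V y"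
proof -
  \<comment> \<open>Coordinates outside V are pinned to 0. The sphere is then a closed subset of a
    product of compact sets, hence compact by Tychonoff.\<close>
  define B where "B u = (if u \<in> V then {-1..1} else {0::real})" for u
  have "compactin (product_topology (\<lambda>_. euclidean) UNIV) (PiE UNIV B)"
    by (subst compactin_PiE) (auto simp: B_def)
  then have "compact (PiE UNIV B)" by (simp add: euclidean_product_topology)
  moreover have cq: "continuous_on UNIV (sq_sum V)" "continuous_on UNIV (quad V D)"
    unfolding sq_sum_def quad_def by (intro continuous_intros continuous_on_product_coordinates)+
  then have "closed {x. sq_sum V x = 1}" by (intro closed_Collect_eq) auto
  ultimately have comp: "compact (PiE UNIV B \<inter> {x. sq_sum V x = 1})" by (rule compact_Int_closed)
  obtain v where v: "v \<in> V" using assms(2) by blast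
  have "(\<lambda>u. if u = v then 1 else 0) \<in> PiE UNIV B \<inter> {x. sq_sum V x = 1}"
    using v assms(1) by (auto simp: B_def sq_sum_def sum.delta if_distrib[of "\<lambda>t. t\<^sup>2"] cong: if_cong)
  then obtain x where x: "x \<in> PiE UNIV B" "sq_sum V x = 1"
    and max: "\<And>y. y \<in> PiE UNIV B \<Longrightarrow> sq_sum V y = 1 \<Longrightarrow> quad V D y \<le> quad V D x"
    using continuous_attains_sup[OF comp, of "quad V D"] cq(2) continuous_on_subset[of UNIV "quad V D"] by auto blast
  have "quad V D y \<le> quad V D x * sq_sum V y" for y
  proof (cases "\<exists>u\<in>V. y u \<noteq> 0")
    case True
    then have pos: "0 < sq_sum V y" using sq_sum_pos[OF assms(1)] by blast
    define r where "r = sqrt (sq_sum V y)"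
    have r: "0 < r" "r\<^sup>2 = sq_sum V y" using pos by (auto simp: r_def)
    define z where "z u = (if u \<in> V then y u / r else 0)" for u
    have z2: "sq_sum V z = 1"
    proof -
      have "sq_sum V z = (\<Sum>u\<in>V. (y u)\<^sup>2 / r\<^sup>2)"
        unfolding sq_sum_def by (intro sum.cong) (auto simp: z_def power_divide)
      also have "\<dots> = sq_sum V y / r\<^sup>2" by (simp add: sq_sum_def sum_divide_distrib)
      finally show ?thesis using r pos by simp
    qed
    have "z u \<in> B u" for u
    proof (cases "u \<in> V")
      case True
      have "(z u)\<^sup>2 \<le> sq_sum V z" unfolding sq_sum_def using True assms(1) by (intro member_le_sum) auto
      then have "\<bar>z u\<bar> \<le> 1" using z2 by (simp add: abs_square_le_1)
      then show ?thesis using True by (auto simp: B_def)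
    qed (simp add: B_def z_def)
    then have "quad V D z \<le> quad V D x" using max[of z] z2 by auto
    moreover have "quad V D z = quad V D y / r\<^sup>2"
    proof -
      have "quad V D z = (\<Sum>u\<in>V. \<Sum>w\<in>V. D u w * (y u * y w) / r\<^sup>2)"
        unfolding quad_def by (intro sum.cong) (auto simp: z_def power2_eq_square)
      then show ?thesis by (simp add: quad_def sum_divide_distrib)
    qed
    ultimately show ?thesis using r pos by (simp add: divide_le_eq)
  next
    case False
    then show ?thesis by (simp add: quad_def sq_sum_def)
  qed
  then show thesis using that x by blast
qed

lemma sum_unit_vector:
  fixes f :: "'a \<Rightarrow> real"
  assumes "finite V" "v \<in> V"
  shows "(\<Sum>u\<in>V. (if u = v then 1 else 0) * f u) = f v"
proof -
  have "(\<Sum>u\<in>V. (if u = v then 1 else 0) * f u) = (\<Sum>u\<in>V. if u = v then f u else 0)"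
    by (intro sum.cong) auto
  then show ?thesis using assms by simp
qed

text \<open>The first-order condition at a maximum. For K > |c| the choice t = a / K would make the
  expression \<open>(a / K)\<^sup>2 * (2 * K + c)\<close>, which is positive unless a = 0.\<close>

lemma linear_coeff_zero:
  assumes "\<And>t::real. 2 * t * a + t\<^sup>2 * c \<le> 0"
  shows "a = 0"
proof (rule ccontr)
  assume "a \<noteq> 0"
  define K where "K = \<bar>c\<bar> + 1"
  have K: "K > 0" "c \<ge> - K" "K > \<bar>c\<bar>" unfolding K_def by auto
  have "2 * (a / K) * a + (a / K)\<^sup>2 * c = (a / K)\<^sup>2 * (2 * K + c)"
    using K(1) by (simp add: field_simps power2_eq_square)
  moreover have "0 < (a / K)\<^sup>2 * (2 * K + c)" using \<open>a \<noteq> 0\<close> K by (intro mult_pos_pos) auto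
  ultimately show False using assms[of "a / K"] by simp
qed

text \<open>Perturbing x by t times the unit vector at v changes the form minus M times the squared
  norm by a quadratic in t without constant term. Maximality makes its linear coefficient vanish,
  and this is the eigenvalue equation in row v.\<close>

lemma maximizer_eigenpair:
  assumes fin: "finite V" and sym: "\<forall>u\<in>V. \<forall>w\<in>V. D u w = D w u"
    and nz: "sq_sum V x = 1" and max: "\<And>y. quad V D y \<le> M * sq_sum V y" and M: "quad V D x = M"
  shows "eigenpair V D M x"
  unfolding eigenpair_def
proof (intro conjI ballI)
  show "\<exists>u\<in>V. x u \<noteq> 0" using nz unfolding sq_sum_def by (metis (mono_tags, lifting) sum.neutral zero_neq_one zero_power2)
  fix v assume v: "v \<in> V"
  let ?e = "\<lambda>u. if u = v then 1 else (0::real)"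
  let ?s = "\<Sum>w\<in>V. D v w * x w"
  have "2 * t * (?s - M * x v) + t\<^sup>2 * (D v v - M) \<le> 0" for t
  proof -
    let ?y = "\<lambda>u. x u + t * ?e u"
    have e2: "(\<Sum>u\<in>V. ?e u * f u) = f v" for f :: "'a \<Rightarrow> real" by (rule sum_unit_vector[OF fin v])
    have e1: "(\<Sum>w\<in>V. D u w * ?e w) = D u v" for u using e2[of "D u"] by (simp only: mult.commute)
    have sx: "(\<Sum>u\<in>V. x u * D u v) = ?s" using sym v by (intro sum.cong) (auto simp: mult.commute)
    have "quad V D ?y = (\<Sum>u\<in>V. \<Sum>w\<in>V. D u w * (x u * x w) + t * (?e u * (D u w * x w))
        + t * (x u * (D u w * ?e w)) + t\<^sup>2 * (?e u * (D u w * ?e w)))"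
      unfolding quad_def by (intro sum.cong refl) (simp add: algebra_simps power2_eq_square)
    also have "\<dots> = M + t * (\<Sum>u\<in>V. ?e u * (\<Sum>w\<in>V. D u w * x w))
        + t * (\<Sum>u\<in>V. x u * (\<Sum>w\<in>V. D u w * ?e w)) + t\<^sup>2 * (\<Sum>u\<in>V. ?e u * (\<Sum>w\<in>V. D u w * ?e w))"
      unfolding M[symmetric] quad_def by (simp only: sum.distrib sum_distrib_left)
    also have "\<dots> = M + t * ?s + t * ?s + t\<^sup>2 * D v v" by (simp only: e1 e2 sx)
    finally have q: "quad V D ?y = M + 2 * t * ?s + t\<^sup>2 * D v v" by (simp add: algebra_simps)
    have "sq_sum V ?y = (\<Sum>u\<in>V. (x u)\<^sup>2 + 2 * t * (?e u * x u) + t\<^sup>2 * (?e u * 1))"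
      unfolding sq_sum_def by (intro sum.cong refl) (simp add: algebra_simps power2_eq_square)
    also have "\<dots> = sq_sum V x + 2 * t * (\<Sum>u\<in>V. ?e u * x u) + t\<^sup>2 * (\<Sum>u\<in>V. ?e u * 1)"
      unfolding sq_sum_def by (simp only: sum.distrib sum_distrib_left)
    also have "\<dots> = 1 + 2 * t * x v + t\<^sup>2 * 1" by (simp only: e2 nz)
    finally have "sq_sum V ?y = 1 + 2 * t * x v + t\<^sup>2" by simp
    then show ?thesis using max[of ?y] unfolding q by (simp add: algebra_simps)
  qed
  then show "?s = M * x v" using linear_coeff_zero by fastforce
qed

lemma eigenvectors_orthogonal:
  assumes "\<forall>u\<in>V. \<forall>w\<in>V. D u w = D w u"
    and "eigenpair V D \<mu> x" "eigenpair V D \<nu> y" "\<mu> \<noteq> \<nu>"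
  shows "(\<Sum>u\<in>V. x u * y u) = 0"
proof -
  have "\<mu> * (\<Sum>u\<in>V. x u * y u) = (\<Sum>u\<in>V. (\<Sum>w\<in>V. D u w * x w) * y u)"
    using assms(2) unfolding eigenpair_def by (simp add: sum_distrib_left mult_ac)
  also have "\<dots> = (\<Sum>u\<in>V. \<Sum>w\<in>V. D u w * x w * y u)" by (simp add: sum_distrib_right)
  also have "\<dots> = (\<Sum>w\<in>V. \<Sum>u\<in>V. D u w * x w * y u)" by (rule sum.swap)
  also have "\<dots> = (\<Sum>w\<in>V. x w * (\<Sum>u\<in>V. D w u * y u))"
    using assms(1) by (auto simp: sum_distrib_left mult_ac intro!: sum.cong)
  also have "\<dots> = \<nu> * (\<Sum>u\<in>V. x u * y u)"
    using assms(3) unfolding eigenpair_def by (simp add: sum_distrib_left mult_ac)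
  finally show ?thesis using assms(4) by simp
qed

text \<open>Bessel's inequality for an orthonormal family of eigenvectors, applied to every unit vector and
  summed, bounds the size of the family by the dimension.\<close>

lemma card_eigenvalues_le:
  assumes fin: "finite V" and sym: "\<forall>u\<in>V. \<forall>w\<in>V. D u w = D w u"
    and L: "finite L" "\<And>\<mu>. \<mu> \<in> L \<Longrightarrow> \<exists>x. eigenpair V D \<mu> x"
  shows "card L \<le> card V"
proof -
  have "\<exists>x. eigenpair V D \<mu> x \<and> sq_sum V x = 1" if \<mu>: "\<mu> \<in> L" for \<mu>
  proof -
    obtain x where x: "eigenpair V D \<mu> x" using L(2)[OF \<mu>] by blast
    then have pos: "0 < sq_sum V x" using sq_sum_pos[OF fin] by (auto simp: eigenpair_def)
    define r where "r = sqrt (sq_sum V x)"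
    have r: "r > 0" "r\<^sup>2 = sq_sum V x" using pos by (auto simp: r_def)
    have "eigenpair V D \<mu> (\<lambda>u. x u / r)"
      using x r(1) unfolding eigenpair_def by (simp add: sum_divide_distrib[symmetric])
    moreover have "sq_sum V (\<lambda>u. x u / r) = 1"
      using r pos by (simp add: sq_sum_def power_divide sum_divide_distrib[symmetric])
    ultimately show ?thesis by blast
  qed
  then obtain X where X: "\<And>\<mu>. \<mu> \<in> L \<Longrightarrow> eigenpair V D \<mu> (X \<mu>)" "\<And>\<mu>. \<mu> \<in> L \<Longrightarrow> sq_sum V (X \<mu>) = 1" by metis
  have orth: "(\<Sum>w\<in>V. X \<mu> w * X \<nu> w) = (if \<mu> = \<nu> then 1 else 0)" if "\<mu> \<in> L" "\<nu> \<in> L" for \<mu> \<nu>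
    using eigenvectors_orthogonal[OF sym X(1)[OF that(1)] X(1)[OF that(2)]] X(2)[OF that(1)]
    by (auto simp: sq_sum_def power2_eq_square)
  have bessel: "(\<Sum>\<mu>\<in>L. (X \<mu> u)\<^sup>2) \<le> 1" if u: "u \<in> V" for u
  proof -
    let ?e = "\<lambda>w. if w = u then 1 else (0::real)"
    \<comment> \<open>\<open>p\<close> is the orthogonal projection of the unit vector at u onto the
      span of the eigenvectors; its squared norm equals its entry at u. Bessel's inequality is then
      the nonnegativity of the squared distance from the unit vector to \<open>p\<close>.\<close>
    define p where "p w = (\<Sum>\<mu>\<in>L. X \<mu> u * X \<mu> w)" for w
    have "(\<Sum>w\<in>V. p w * p w) = (\<Sum>w\<in>V. \<Sum>\<mu>\<in>L. \<Sum>\<nu>\<in>L. X \<mu> u * X \<nu> u * (X \<mu> w * X \<nu> w))"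
      by (simp add: p_def sum_product mult_ac)
    also have "\<dots> = (\<Sum>\<mu>\<in>L. \<Sum>w\<in>V. \<Sum>\<nu>\<in>L. X \<mu> u * X \<nu> u * (X \<mu> w * X \<nu> w))" by (rule sum.swap)
    also have "\<dots> = (\<Sum>\<mu>\<in>L. \<Sum>\<nu>\<in>L. \<Sum>w\<in>V. X \<mu> u * X \<nu> u * (X \<mu> w * X \<nu> w))"
      by (intro sum.cong refl sum.swap)
    also have "\<dots> = (\<Sum>\<mu>\<in>L. \<Sum>\<nu>\<in>L. X \<mu> u * X \<nu> u * (if \<mu> = \<nu> then 1 else 0))"
      using orth by (intro sum.cong refl) (simp add: sum_distrib_left[symmetric])
    also have "\<dots> = p u"
      unfolding p_def using L(1) by (intro sum.cong refl) (simp add: sum.delta' if_distrib cong: if_cong)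
    finally have pp: "(\<Sum>w\<in>V. p w * p w) = p u" .
    have "0 \<le> (\<Sum>w\<in>V. (?e w - p w)\<^sup>2)" by (intro sum_nonneg) auto
    also have "\<dots> = (\<Sum>w\<in>V. ?e w * (1 - 2 * p w) + p w * p w)"
      by (intro sum.cong refl) (simp add: power2_eq_square algebra_simps)
    also have "\<dots> = (1 - 2 * p u) + p u"
      unfolding sum.distrib pp sum_unit_vector[OF fin u] ..
    finally show ?thesis by (simp add: p_def power2_eq_square)
  qed
  have "real (card L) = (\<Sum>\<mu>\<in>L. sq_sum V (X \<mu>))" using X(2) by simp
  also have "\<dots> = (\<Sum>u\<in>V. \<Sum>\<mu>\<in>L. (X \<mu> u)\<^sup>2)" unfolding sq_sum_def by (rule sum.swap)
  also have "\<dots> \<le> (\<Sum>u\<in>V. 1)" using bessel by (intro sum_mono) auto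
  finally show ?thesis by simp
qed

text \<open>\<open>Max\<close> has its intended meaning only on a finite nonempty set, so this is
  what gives content to \<open>dist_lambda1\<close>.\<close>

lemma finite_eigenvalues:
  assumes "finite V" and "\<forall>u\<in>V. \<forall>w\<in>V. D u w = D w u"
  shows "finite {\<mu>. \<exists>x. eigenpair V D \<mu> x}"
proof (rule ccontr)
  assume "infinite {\<mu>. \<exists>x. eigenpair V D \<mu> x}"
  then obtain L where "L \<subseteq> {\<mu>. \<exists>x. eigenpair V D \<mu> x}" "finite L" "card L = Suc (card V)"
    using infinite_arbitrarily_large by blast
  then show False using card_eigenvalues_le[OF assms, where L = L] by auto
qed

text \<open>A maximizer of the Rayleigh quotient is an eigenvector, and every eigenvalue is the
  Rayleigh quotient of its eigenvector; hence the two maxima agree.\<close>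

lemma Max_eigenvalue:
  assumes fin: "finite V" "V \<noteq> {}" and sym: "\<forall>u\<in>V. \<forall>w\<in>V. D u w = D w u"
  shows "quad V D y \<le> Max {\<mu>. \<exists>x. eigenpair V D \<mu> x} * sq_sum V y"
    and "\<exists>x. sq_sum V x = 1 \<and> quad V D x = Max {\<mu>. \<exists>x. eigenpair V D \<mu> x}"
proof -
  let ?ev = "{\<mu>. \<exists>x. eigenpair V D \<mu> x}"
  obtain x where x: "sq_sum V x = 1" "\<And>y. quad V D y \<le> quad V D x * sq_sum V y"
    using max_rayleigh[OF fin] by metis
  have ev: "quad V D x \<in> ?ev" using maximizer_eigenpair[OF fin(1) sym x] by auto
  have "\<mu> \<le> quad V D x" if ev: "\<mu> \<in> ?ev" for \<mu>
  proof -
    obtain z where z: "eigenpair V D \<mu> z" using ev by blast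
    then have "0 < sq_sum V z" using sq_sum_pos[OF fin(1)] by (auto simp: eigenpair_def)
    then show ?thesis using x(2)[of z] quad_eigenpair[OF z] by simp
  qed
  then have "Max ?ev = quad V D x" using ev finite_eigenvalues[OF fin(1) sym] by (intro Max_eqI) auto
  then show "quad V D y \<le> Max ?ev * sq_sum V y" "\<exists>x. sq_sum V x = 1 \<and> quad V D x = Max ?ev"
    using x by auto
qed

text \<open>Taking absolute values of a maximizer does not lower the form, since the entries are
  nonnegative, so the result is again an eigenvector. If it vanished at u, row u of the eigenvalue
  equation would be a vanishing sum of nonnegative terms with positive off-diagonal weights, forcing
  the whole vector to be zero.\<close>

lemma perron_vector:
  assumes fin: "finite V" "V \<noteq> {}" and sym: "\<forall>u\<in>V. \<forall>w\<in>V. D u w = D w u"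
    and pos: "\<And>u w. u \<in> V \<Longrightarrow> w \<in> V \<Longrightarrow> u \<noteq> w \<Longrightarrow> 0 < D u w" and nonneg: "\<And>u. u \<in> V \<Longrightarrow> 0 \<le> D u u"
  obtains x where "eigenpair V D (Max {\<mu>. \<exists>x. eigenpair V D \<mu> x}) x" "\<And>u. u \<in> V \<Longrightarrow> 0 < x u"
proof -
  let ?M = "Max {\<mu>. \<exists>x. eigenpair V D \<mu> x}"
  note M = Max_eigenvalue[OF fin sym]
  obtain z where z: "sq_sum V z = 1" "quad V D z = ?M" using M(2) by blast
  define x where "x u = \<bar>z u\<bar>" for u
  have D0: "0 \<le> D u w" if "u \<in> V" "w \<in> V" for u w using pos[OF that] nonneg[OF that(1)] by (cases "u = w") auto
  have x1: "sq_sum V x = 1" using z(1) by (simp add: sq_sum_def x_def)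
  have "quad V D z \<le> quad V D x"
    unfolding quad_def x_def
  proof (intro sum_mono mult_left_mono)
    show "z u * z w \<le> \<bar>z u\<bar> * \<bar>z w\<bar>" for u w by (metis abs_ge_self abs_mult)
  qed (use D0 in auto)
  moreover have "quad V D x \<le> ?M" using M(1)[of x] x1 by simp
  ultimately have "quad V D x = ?M" using z(2) by simp
  then have ep: "eigenpair V D ?M x" using maximizer_eigenpair[OF fin(1) sym x1 M(1)] by blast
  have "0 < x u" if u: "u \<in> V" for u
  proof (rule ccontr)
    assume "\<not> 0 < x u"
    then have xu: "x u = 0" by (simp add: x_def)
    then have "(\<Sum>w\<in>V. D u w * x w) = 0" using ep u by (simp add: eigenpair_def)
    then have "D u w * x w = 0" if "w \<in> V" for w
      using that D0[OF u] fin(1) by (subst (asm) sum_nonneg_eq_0_iff) (auto simp: x_def)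
    then have "x w = 0" if "w \<in> V" for w
      using pos[OF u that] xu that by (cases "u = w") force+
    then show False using ep by (auto simp: eigenpair_def)
  qed
  then show thesis using that ep by blast
qed

text \<open>The upper half of the Collatz-Wielandt bound: compare z with y in the row u where |z| /
  y is largest.\<close>

lemma eigenvalue_le_test_vector:
  assumes fin: "finite V" and nonneg: "\<And>u w. u \<in> V \<Longrightarrow> w \<in> V \<Longrightarrow> 0 \<le> D u w"
    and y: "\<And>u. u \<in> V \<Longrightarrow> 0 < y u" "\<And>u. u \<in> V \<Longrightarrow> (\<Sum>w\<in>V. D u w * y w) \<le> M * y u"
    and ep: "eigenpair V D \<mu> z"
  shows "\<mu> \<le> M"
proof -
  obtain v where v: "v \<in> V" "z v \<noteq> 0" using ep by (auto simp: eigenpair_def)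
  obtain u where u: "u \<in> V" and max: "\<And>w. w \<in> V \<Longrightarrow> \<bar>z w\<bar> / y w \<le> \<bar>z u\<bar> / y u"
  proof -
    let ?f = "\<lambda>w. \<bar>z w\<bar> / y w"
    have "V \<noteq> {}" using v by blast
    then obtain u where "u \<in> V" "Max (?f ` V) = ?f u" by (rule obtains_MAX[OF fin])
    then show thesis using that[of u] Max_ge[OF finite_imageI[OF fin, of ?f]] by auto
  qed
  define t where "t = \<bar>z u\<bar> / y u"
  have t: "t > 0" using max[OF v(1)] v y(1)[OF v(1)] unfolding t_def
    by (metis divide_pos_pos less_le_trans zero_less_abs_iff)
  have zw: "\<bar>z w\<bar> \<le> t * y w" if "w \<in> V" for w
    using max[OF that] y(1)[OF that] unfolding t_def by (simp add: divide_le_eq)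
  have zu: "\<bar>z u\<bar> = t * y u" using y(1)[OF u] by (simp add: t_def)
  have "\<mu> * \<bar>z u\<bar> \<le> \<bar>\<mu> * z u\<bar>" by (simp add: abs_mult mult_right_mono)
  also have "\<dots> = \<bar>\<Sum>w\<in>V. D u w * z w\<bar>" using ep u by (simp add: eigenpair_def)
  also have "\<dots> \<le> (\<Sum>w\<in>V. D u w * (t * y w))"
    by (rule order_trans[OF sum_abs], rule sum_mono) (use nonneg[OF u] zw in \<open>auto simp: abs_mult intro!: mult_left_mono\<close>)
  also have "\<dots> = t * (\<Sum>w\<in>V. D u w * y w)" by (simp add: sum_distrib_left mult_ac)
  also have "\<dots> \<le> t * (M * y u)" using y(2)[OF u] t by (intro mult_left_mono) auto
  also have "\<dots> = M * \<bar>z u\<bar>" using zu by simp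
  finally show ?thesis using zu t y(1)[OF u] by (metis mult_le_cancel_right_pos mult_pos_pos)
qed

section \<open>Distance matrices\<close>

abbreviation dmat :: "'a set \<Rightarrow> 'a set set \<Rightarrow> 'a \<Rightarrow> 'a \<Rightarrow> real" where
  "dmat V E u w \<equiv> real (gdist V E u w)"

lemma dist_lambda1_eq: "dist_lambda1 V E = Max {\<mu>. \<exists>x. eigenpair V (dmat V E) \<mu> x}"
  by (simp add: dist_lambda1_def dist_eigenvalue_def eigenpair_def)

lemma is_walk_rev: "is_walk V E xs u v m \<Longrightarrow> is_walk V E (rev xs) v u m"
  unfolding is_walk_def adj_def
  by (auto simp: hd_rev last_rev successively_rev insert_commute elim!: successively_mono)

lemma gdist_sym: "gdist V E u v = gdist V E v u"
proof -
  have "(\<exists>xs. is_walk V E xs u v m) \<longleftrightarrow> (\<exists>xs. is_walk V E xs v u m)" for m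
    using is_walk_rev[of V E _ u v m] is_walk_rev[of V E _ v u m] by blast
  then show ?thesis by (simp add: gdist_def)
qed

lemma gdist_le: "is_walk V E xs u v m \<Longrightarrow> gdist V E u v \<le> m"
  unfolding gdist_def by (rule Least_le) blast

lemma gdist_self: "u \<in> V \<Longrightarrow> gdist V E u u = 0"
  using gdist_le[of V E "[u]" u u 0] by (simp add: is_walk_def)

lemma gdist_adj_le: "u \<in> V \<Longrightarrow> v \<in> V \<Longrightarrow> adj E u v \<Longrightarrow> gdist V E u v \<le> 1"
  using gdist_le[of V E "[u, v]" u v 1] by (simp add: is_walk_def)

lemma gdist_walk:
  assumes "connected_graph V E" "u \<in> V" "v \<in> V"
  obtains xs where "is_walk V E xs u v (gdist V E u v)"
proof -
  have "\<exists>m. \<exists>xs. is_walk V E xs u v m" using assms unfolding connected_graph_def by blast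
  then have "\<exists>xs. is_walk V E xs u v (gdist V E u v)" unfolding gdist_def by (rule LeastI_ex)
  then show thesis using that by blast
qed

lemma gdist_ge_1:
  assumes "connected_graph V E" "u \<in> V" "v \<in> V" "u \<noteq> v"
  shows "1 \<le> gdist V E u v"
proof (rule ccontr)
  obtain xs where w: "is_walk V E xs u v (gdist V E u v)" by (rule gdist_walk[OF assms(1-3)])
  assume "\<not> 1 \<le> gdist V E u v"
  then have "length xs = 1" using w unfolding is_walk_def by simp
  then obtain a where "xs = [a]" by (auto simp: length_Suc_conv)
  then show False using w assms(4) by (auto simp: is_walk_def)
qed

lemma gdist_ge_2:
  assumes "connected_graph V E" "u \<in> V" "v \<in> V" "u \<noteq> v" "\<not> adj E u v"
  shows "2 \<le> gdist V E u v"
proof (rule ccontr)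
  obtain xs where w: "is_walk V E xs u v (gdist V E u v)" by (rule gdist_walk[OF assms(1-3)])
  assume "\<not> 2 \<le> gdist V E u v"
  then have "gdist V E u v = 1" using gdist_ge_1[OF assms(1-4)] by simp
  then obtain a b where "xs = [a, b]" using w unfolding is_walk_def by (auto simp: length_Suc_conv)
  then show False using w assms(5) by (auto simp: is_walk_def)
qed

lemma dmat_sym: "\<forall>u\<in>V. \<forall>w\<in>V. dmat V E u w = dmat V E w u"
  using gdist_sym by metis

lemma rayleigh_le:
  assumes "finite V" "V \<noteq> {}"
  shows "quad V (dmat V E) x \<le> dist_lambda1 V E * sq_sum V x"
  unfolding dist_lambda1_eq by (rule Max_eigenvalue(1)[OF assms dmat_sym])

lemma graph_perron_vector:
  assumes "finite V" "V \<noteq> {}" "connected_graph V E"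
  obtains x where "eigenpair V (dmat V E) (dist_lambda1 V E) x" "\<And>u. u \<in> V \<Longrightarrow> 0 < x u"
  unfolding dist_lambda1_eq
proof (rule perron_vector[OF assms(1,2) dmat_sym, of E])
  show "0 < dmat V E u w" if "u \<in> V" "w \<in> V" "u \<noteq> w" for u w using gdist_ge_1[OF assms(3) that] by simp
qed (use that in auto)

lemma dist_lambda1_le:
  assumes fin: "finite V" "V \<noteq> {}"
    and y: "\<And>u. u \<in> V \<Longrightarrow> 0 < y u" "\<And>u. u \<in> V \<Longrightarrow> (\<Sum>w\<in>V. dmat V E u w * y w) \<le> M * y u"
  shows "dist_lambda1 V E \<le> M"
proof -
  obtain x where x: "sq_sum V x = 1" "quad V (dmat V E) x = dist_lambda1 V E"
    using Max_eigenvalue(2)[OF fin dmat_sym, of E] unfolding dist_lambda1_eq by blast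
  then have "eigenpair V (dmat V E) (dist_lambda1 V E) x"
    using rayleigh_le[OF fin, of E] by (intro maximizer_eigenpair[OF fin(1) dmat_sym]) auto
  then show ?thesis using eigenvalue_le_test_vector[OF fin(1) _ y] by force
qed

lemma quad_mono:
  assumes "\<And>u w. u \<in> V \<Longrightarrow> w \<in> V \<Longrightarrow> C u w \<le> D u w" "\<And>u. u \<in> V \<Longrightarrow> 0 \<le> x u"
  shows "quad V C x \<le> quad V D x"
  unfolding quad_def by (intro sum_mono mult_right_mono assms mult_nonneg_nonneg)

lemma sum_restrict_of_bool:
  fixes x :: "'a \<Rightarrow> real"
  assumes "finite V" "I \<subseteq> V"
  shows "(\<Sum>u\<in>V. of_bool (u \<in> I) * x u) = sum x I"
  using assms by (intro sum.mono_neutral_cong_right) auto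

text \<open>The lower bound is the quadratic form of the distance matrix of the join of the complete graph
  on S with the disjoint union of the independent set I and the complete graph on the rest.\<close>

lemma rayleigh_barrier:
  assumes G: "simple_graph V E" "connected_graph V E" "V \<noteq> {}"
    and S: "S \<subseteq> V" "I \<subseteq> isolated (adj E) (V - S)" and x: "\<And>u. u \<in> V \<Longrightarrow> 0 \<le> x u"
  shows "(sum x V)\<^sup>2 - sq_sum V x + 2 * sum x I * sum x (V - S - I) + (sum x I)\<^sup>2 - sq_sum I x
    \<le> dist_lambda1 V E * sq_sum V x"
proof -
  have fin: "finite V" using G(1) by (simp add: simple_graph_def)
  have I: "I \<subseteq> V - S" using S(2) by (auto simp: isolated_def)
  let ?J = "V - S - I"
  let ?d = "\<lambda>u w. of_bool (w = u) :: real" and ?i = "\<lambda>u. of_bool (u \<in> I) :: real"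
  let ?j = "\<lambda>u. of_bool (u \<in> ?J) :: real" and ?r = "\<lambda>u. of_bool (u \<in> V - S) :: real"
  \<comment> \<open>Off the diagonal every pair counts 1. The terms with \<open>?i\<close> and
    \<open>?r\<close> add 1 for pairs from I to another vertex outside S, and the last term adds 1
    for pairs from the remaining vertices to I.\<close>
  define C where "C u w = 1 - ?d u w + ?i u * ?r w - ?i u * ?d u w + ?j u * ?i w" for u w
  have CD: "C u w \<le> dmat V E u w" if uw: "u \<in> V" "w \<in> V" for u w
  proof (cases "u = w")
    case True
    then show ?thesis using I uw by (auto simp: C_def gdist_self)
  next
    case False
    have "2 \<le> gdist V E u w" if "(u \<in> I \<and> w \<in> V - S) \<or> (u \<in> V - S \<and> w \<in> I)"
    proof (rule gdist_ge_2[OF G(2) uw False])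
      show "\<not> adj E u w" using that S(2) sympD[OF symp_adj, of E u w] by (auto simp: isolated_def)
    qed
    moreover have "1 \<le> gdist V E u w" by (rule gdist_ge_1[OF G(2) uw False])
    ultimately show ?thesis using False by (auto simp: C_def of_bool_def)
  qed
  have "quad V C x = (\<Sum>u\<in>V. \<Sum>w\<in>V. x u * x w - ?d u w * (x u * x w) + (?i u * x u) * (?r w * x w)
      - ?d u w * (?i u * x u * x w) + (?j u * x u) * (?i w * x w))"
    unfolding quad_def C_def by (intro sum.cong refl) (simp add: algebra_simps)
  also have "\<dots> = (\<Sum>u\<in>V. \<Sum>w\<in>V. x u * x w) - (\<Sum>u\<in>V. \<Sum>w\<in>V. ?d u w * (x u * x w))
      + (\<Sum>u\<in>V. \<Sum>w\<in>V. (?i u * x u) * (?r w * x w)) - (\<Sum>u\<in>V. \<Sum>w\<in>V. ?d u w * (?i u * x u * x w))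
      + (\<Sum>u\<in>V. \<Sum>w\<in>V. (?j u * x u) * (?i w * x w))"
    by (simp only: sum.distrib sum_subtractf)
  also have "\<dots> = (sum x V)\<^sup>2 - sq_sum V x + sum x I * sum x (V - S) - sq_sum I x + sum x ?J * sum x I"
  proof -
    have d: "(\<Sum>w\<in>V. ?d u w * f w) = f u" if "u \<in> V" for u and f :: "'a \<Rightarrow> real"
      using sum_unit_vector[OF fin that, of f] by (simp add: of_bool_def)
    have "(\<Sum>u\<in>V. \<Sum>w\<in>V. ?d u w * (x u * x w)) = sq_sum V x"
      unfolding sq_sum_def by (intro sum.cong refl) (simp only: d power2_eq_square)
    moreover have "(\<Sum>u\<in>V. \<Sum>w\<in>V. ?d u w * (?i u * x u * x w)) = sq_sum I x"
    proof -
      have "(\<Sum>u\<in>V. \<Sum>w\<in>V. ?d u w * (?i u * x u * x w)) = (\<Sum>u\<in>V. ?i u * (x u)\<^sup>2)"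
        by (intro sum.cong refl) (simp only: d power2_eq_square mult.assoc)
      then show ?thesis unfolding sq_sum_def using sum_restrict_of_bool[OF fin, of I "\<lambda>u. (x u)\<^sup>2"] I by auto
    qed
    moreover have "(\<Sum>u\<in>V. \<Sum>w\<in>V. (?i u * x u) * (?r w * x w)) = sum x I * sum x (V - S)"
      unfolding sum_product[symmetric] using I by (subst (1 2) sum_restrict_of_bool[OF fin]) auto
    moreover have "(\<Sum>u\<in>V. \<Sum>w\<in>V. (?j u * x u) * (?i w * x w)) = sum x ?J * sum x I"
      unfolding sum_product[symmetric] using I by (subst (1 2) sum_restrict_of_bool[OF fin]) auto
    ultimately show ?thesis by (simp add: sum_product[symmetric] power2_eq_square)
  qed
  also have "sum x (V - S) = sum x I + sum x ?J"
    using I fin by (metis add.commute finite_Diff sum.subset_diff)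
  finally have "quad V C x = (sum x V)\<^sup>2 - sq_sum V x + 2 * sum x I * sum x ?J + (sum x I)\<^sup>2 - sq_sum I x"
    by (simp add: algebra_simps power2_eq_square)
  moreover have "quad V C x \<le> quad V (dmat V E) x" by (rule quad_mono[OF CD x])
  ultimately show ?thesis using rayleigh_le[OF fin G(3), of E x] by simp
qed

text \<open>The Rayleigh quotient of the all-ones vector: each ordered pair of distinct vertices
  contributes at least 1, and a nonadjacent pair at least one more.\<close>

lemma rayleigh_nonadjacent:
  assumes G: "simple_graph V E" "connected_graph V E" "V \<noteq> {}"
  shows "real (card V) * (real (card V) - 1) + (\<Sum>u\<in>V. real (card {w \<in> V. w \<noteq> u \<and> \<not> adj E u w}))
    \<le> dist_lambda1 V E * real (card V)"
proof -
  have fin: "finite V" using G(1) by (simp add: simple_graph_def)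
  have row: "(\<Sum>w\<in>V. dmat V E u w) \<ge> (real (card V) - 1) + real (card {w \<in> V. w \<noteq> u \<and> \<not> adj E u w})"
    if u: "u \<in> V" for u
  proof -
    have "(\<Sum>w\<in>V. dmat V E u w) \<ge> (\<Sum>w\<in>V. of_bool (w \<noteq> u) + of_bool (w \<noteq> u \<and> \<not> adj E u w))"
    proof (rule sum_mono)
      fix w assume w: "w \<in> V"
      show "of_bool (w \<noteq> u) + of_bool (w \<noteq> u \<and> \<not> adj E u w) \<le> dmat V E u w"
        using gdist_ge_1[OF G(2) u w] gdist_ge_2[OF G(2) u w] by (auto simp: of_bool_def)
    qed
    also have "(\<Sum>w\<in>V. of_bool (w \<noteq> u) + of_bool (w \<noteq> u \<and> \<not> adj E u w)) =
        real (card (V - {u})) + real (card {w \<in> V. w \<noteq> u \<and> \<not> adj E u w})"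
    proof -
      have "V \<inter> {w. w \<noteq> u} = V - {u}" "V \<inter> {w. w \<noteq> u \<and> \<not> adj E u w} = {w \<in> V. w \<noteq> u \<and> \<not> adj E u w}" by auto
      then show ?thesis using fin by (simp add: sum.distrib sum_of_bool_eq)
    qed
    also have "real (card (V - {u})) = real (card V) - 1"
      using card.remove[OF fin u] by simp
    finally show ?thesis .
  qed
  have "real (card V) * (real (card V) - 1) + (\<Sum>u\<in>V. real (card {w \<in> V. w \<noteq> u \<and> \<not> adj E u w}))
      = (\<Sum>u\<in>V. (real (card V) - 1) + real (card {w \<in> V. w \<noteq> u \<and> \<not> adj E u w}))"
    by (simp add: sum.distrib)
  also have "\<dots> \<le> (\<Sum>u\<in>V. \<Sum>w\<in>V. dmat V E u w)" by (intro sum_mono row)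
  also have "\<dots> = quad V (dmat V E) (\<lambda>_. 1)" by (simp add: quad_def)
  also have "\<dots> \<le> dist_lambda1 V E * sq_sum V (\<lambda>_. 1)" by (rule rayleigh_le[OF fin G(3)])
  finally show ?thesis by (simp add: sq_sum_def)
qed

text \<open>The target has diameter at most two, so transporting it along f bounds the distance
  matrix of G from below entrywise: nonadjacent vertices of G already have distance at least two. If
  f missed an edge, one entry would be strictly larger, and the positive Perron vector of the target
  would turn this into a strict increase of the spectral radius.\<close>

lemma dist_lambda1_spanning_subgraph:
  assumes G: "simple_graph V E" "connected_graph V E"
    and T: "simple_graph W F" "connected_graph W F" "W \<noteq> {}"
      "\<And>u w. u \<in> W \<Longrightarrow> w \<in> W \<Longrightarrow> gdist W F u w \<le> 2"
    and f: "bij_betw f V W" "\<And>u w. u \<in> V \<Longrightarrow> w \<in> V \<Longrightarrow> {u, w} \<in> E \<Longrightarrow> {f u, f w} \<in> F"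
    and le: "dist_lambda1 V E \<le> dist_lambda1 W F"
  shows "graph_iso V E W F"
proof (rule ccontr)
  assume "\<not> graph_iso V E W F"
  then obtain p q where pq: "p \<in> V" "q \<in> V" "{f p, f q} \<in> F" "{p, q} \<notin> E"
    using f unfolding graph_iso_def by metis
  have fin: "finite V" "finite W" using G(1) T(1) by (auto simp: simple_graph_def)
  have fW: "f u \<in> W" if "u \<in> V" for u using f(1) that bij_betwE by fast
  have V: "V \<noteq> {}" using pq by blast
  obtain z where z: "eigenpair W (dmat W F) (dist_lambda1 W F) z" "\<And>u. u \<in> W \<Longrightarrow> 0 < z u"
    using graph_perron_vector[OF fin(2) T(3,2)] by blast
  let ?x = "\<lambda>u. z (f u)" and ?C = "\<lambda>u w. dmat W F (f u) (f w)"
  have CD: "?C u w \<le> dmat V E u w" if uw: "u \<in> V" "w \<in> V" for u w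
  proof (cases "u = w")
    case True
    then show ?thesis using uw fW by (simp add: gdist_self)
  next
    case False
    show ?thesis
    proof (cases "adj F (f u) (f w)")
      case True
      then show ?thesis using gdist_adj_le[OF fW[OF uw(1)] fW[OF uw(2)] True] gdist_ge_1[OF G(2) uw False] by simp
    next
      case notadj: False
      then have "\<not> adj E u w" using f(2)[OF uw] by (auto simp: adj_def)
      then show ?thesis using gdist_ge_2[OF G(2) uw False] T(4)[OF fW[OF uw(1)] fW[OF uw(2)]] by simp
    qed
  qed
  have "p \<noteq> q" using pq(3) irreflp_adj[OF T(1)] by (auto simp: adj_def irreflp_def)
  then have strict: "?C p q < dmat V E p q"
    using gdist_adj_le[OF fW[OF pq(1)] fW[OF pq(2)], of F] gdist_ge_2[OF G(2) pq(1,2)] pq(3,4)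
    by (auto simp: adj_def)
  have xpos: "0 < ?x u * ?x w" if "u \<in> V" "w \<in> V" for u w using z(2) fW that by simp
  have entry: "?C u w * (?x u * ?x w) \<le> dmat V E u w * (?x u * ?x w)" if "u \<in> V" "w \<in> V" for u w
    using CD[OF that] xpos[OF that] by (intro mult_right_mono) auto
  have "(\<Sum>w\<in>V. ?C p w * (?x p * ?x w)) < (\<Sum>w\<in>V. dmat V E p w * (?x p * ?x w))"
  proof (rule sum_strict_mono_ex1[OF fin(1)])
    have "?C p q * (?x p * ?x q) < dmat V E p q * (?x p * ?x q)"
      using strict xpos[OF pq(1,2)] by (rule mult_strict_right_mono)
    then show "\<exists>w\<in>V. ?C p w * (?x p * ?x w) < dmat V E p w * (?x p * ?x w)" using pq(2) by blast
  qed (use entry pq(1) in blast)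
  then have "quad V ?C ?x < quad V (dmat V E) ?x"
    unfolding quad_def using pq(1) entry by (intro sum_strict_mono_ex1[OF fin(1)]) (auto intro!: sum_mono)
  moreover have "quad V ?C ?x = quad W (dmat W F) z"
    unfolding quad_def by (subst sum.reindex_bij_betw[OF f(1), symmetric], subst sum.reindex_bij_betw[OF f(1), symmetric]) simp
  moreover have "sq_sum V ?x = sq_sum W z"
    unfolding sq_sum_def by (rule sum.reindex_bij_betw[OF f(1)])
  moreover have "quad W (dmat W F) z = dist_lambda1 W F * sq_sum W z" by (rule quad_eigenpair[OF z(1)])
  moreover have "quad V (dmat V E) ?x \<le> dist_lambda1 V E * sq_sum V ?x" by (rule rayleigh_le[OF fin(1) V])
  ultimately have "dist_lambda1 W F * sq_sum W z < dist_lambda1 V E * sq_sum W z" by simp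
  moreover have "0 \<le> sq_sum W z" by (simp add: sq_sum_def sum_nonneg)
  ultimately show False using le mult_right_mono[OF le, of "sq_sum W z"] by simp
qed

section \<open>Distances in a graph with a dominating vertex\<close>

lemma dominating_vertex:
  assumes "simple_graph V E" "c \<in> V" "\<And>u. u \<in> V \<Longrightarrow> u \<noteq> c \<Longrightarrow> adj E c u"
  shows "connected_graph V E"
    and "\<And>u w. u \<in> V \<Longrightarrow> w \<in> V \<Longrightarrow> gdist V E u w = (if u = w then 0 else if adj E u w then 1 else 2)"
proof -
  have uc: "adj E u c" if "u \<in> V" "u \<noteq> c" for u using assms(3)[OF that] sympD[OF symp_adj] by metis
  have w2: "is_walk V E [u, c, w] u w 2" if "u \<in> V" "w \<in> V" "u \<noteq> c" "w \<noteq> c" for u w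
    using that assms uc by (simp add: is_walk_def)
  have w1: "is_walk V E [u, w] u w 1" if "u \<in> V" "w \<in> V" "adj E u w" for u w
    using that by (simp add: is_walk_def)
  have w0: "is_walk V E [u] u u 0" if "u \<in> V" for u using that by (simp add: is_walk_def)
  show con: "connected_graph V E"
    unfolding connected_graph_def
  proof (intro ballI)
    fix u w assume uw: "u \<in> V" "w \<in> V"
    consider "u = w" | "u \<noteq> w" "u = c \<or> w = c" | "u \<noteq> c" "w \<noteq> c" by blast
    then show "\<exists>xs m. is_walk V E xs u w m"
    proof cases
      case 1 then show ?thesis using w0 uw by blast
    next
      case 2 then show ?thesis using w1[OF uw] assms(3) uc uw by metis
    next
      case 3 then show ?thesis using w2 uw by blast
    qed
  qed
  fix u w assume uw: "u \<in> V" "w \<in> V"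
  show "gdist V E u w = (if u = w then 0 else if adj E u w then 1 else 2)"
  proof (cases "u = w \<or> adj E u w")
    case True
    then show ?thesis
      using gdist_self[OF uw(1)] gdist_adj_le[OF uw] gdist_ge_1[OF con uw] by force
  next
    case False
    then have "u \<noteq> c" "w \<noteq> c" using assms(3) uc uw by auto
    then show ?thesis using False gdist_le[OF w2[OF uw]] gdist_ge_2[OF con uw] by auto
  qed
qed

text \<open>The distance matrix is the all-ones matrix minus the identity plus the adjacency matrix
  of the complement. Every row of the two extremal graphs is computed from this form.\<close>

lemma dominating_row_sum:
  assumes "simple_graph V E" "c \<in> V" "\<And>u. u \<in> V \<Longrightarrow> u \<noteq> c \<Longrightarrow> adj E c u" "u \<in> V"
  shows "(\<Sum>w\<in>V. dmat V E u w * z w) = sum z V - z u + sum z {w \<in> V. w \<noteq> u \<and> \<not> adj E u w}"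
proof -
  have fin: "finite V" using assms(1) by (simp add: simple_graph_def)
  have "(\<Sum>w\<in>V. dmat V E u w * z w) =
      (\<Sum>w\<in>V. z w - of_bool (w = u) * z w + of_bool (w \<in> {w \<in> V. w \<noteq> u \<and> \<not> adj E u w}) * z w)"
    using dominating_vertex(2)[OF assms] by (intro sum.cong refl) auto
  also have "\<dots> = sum z V - z u + sum z {w \<in> V. w \<noteq> u \<and> \<not> adj E u w}"
    unfolding sum.distrib sum_subtractf
    using sum_unit_vector[OF fin assms(4), of z] sum_restrict_of_bool[OF fin, of "{w \<in> V. w \<noteq> u \<and> \<not> adj E u w}" z]
    by (simp add: of_bool_def)
  finally show ?thesis .
qed

section \<open>The two extremal graphs\<close>

lemma adj_KKK: "adj (KKK_edges n) u w \<longleftrightarrow>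
    u \<noteq> w \<and> u < n \<and> w < n \<and> ((u < n - 1 \<and> w < n - 1) \<or> u = 0 \<or> w = 0)"
  unfolding adj_def KKK_edges_def by (auto simp: doubleton_eq_iff)

lemma adj_S: "adj (S_edges n k) u w \<longleftrightarrow> u \<noteq> w \<and> u < n \<and> w < n \<and> (u < k \<or> w < k)"
  unfolding adj_def S_edges_def by (auto simp: doubleton_eq_iff)

lemma simple_KKK: "simple_graph {0..<n} (KKK_edges n)"
  unfolding simple_graph_def KKK_edges_def by fastforce

lemma simple_S: "simple_graph {0..<n} (S_edges n k)"
  unfolding simple_graph_def S_edges_def by fastforce

lemma KKK_row_sum:
  assumes "3 \<le> n" "u < n"
  shows "(\<Sum>w\<in>{0..<n}. dmat {0..<n} (KKK_edges n) u w * z w) = sum z {0..<n} - z u +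
    (if u = 0 then 0 else if u = n - 1 then sum z {0..<n} - z 0 - z (n - 1) else z (n - 1))"
proof -
  let ?N = "{w \<in> {0..<n}. w \<noteq> u \<and> \<not> adj (KKK_edges n) u w}"
  have "(\<Sum>w\<in>{0..<n}. dmat {0..<n} (KKK_edges n) u w * z w) = sum z {0..<n} - z u + sum z ?N"
    by (rule dominating_row_sum[OF simple_KKK, of 0]) (use assms in \<open>auto simp: adj_KKK\<close>)
  moreover have "sum z ?N = (if u = 0 then 0 else if u = n - 1 then sum z {0..<n} - z 0 - z (n - 1) else z (n - 1))"
  proof -
    consider "u = 0" | "u = n - 1" "u \<noteq> 0" | "u \<noteq> 0" "u \<noteq> n - 1" by blast
    then show ?thesis
    proof cases
      case 1
      then have N: "?N = {}" by (auto simp: adj_KKK)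
      show ?thesis unfolding N using 1 by simp
    next
      case 2
      then have N: "?N = {0..<n} - {0} - {n - 1}" using assms by (auto simp: adj_KKK)
      show ?thesis unfolding N using 2 assms by (simp add: sum_diff1)
    next
      case 3
      then have N: "?N = {n - 1}" using assms by (auto simp: adj_KKK)
      show ?thesis unfolding N using 3 by simp
    qed
  qed
  ultimately show ?thesis by simp
qed

lemma S_row_sum:
  assumes "1 \<le> k" "k \<le> n" "u < n"
  shows "(\<Sum>w\<in>{0..<n}. dmat {0..<n} (S_edges n k) u w * z w) = sum z {0..<n} - z u +
    (if u < k then 0 else sum z {k..<n} - z u)"
proof -
  let ?N = "{w \<in> {0..<n}. w \<noteq> u \<and> \<not> adj (S_edges n k) u w}"
  have "(\<Sum>w\<in>{0..<n}. dmat {0..<n} (S_edges n k) u w * z w) = sum z {0..<n} - z u + sum z ?N"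
    by (rule dominating_row_sum[OF simple_S, of 0]) (use assms in \<open>auto simp: adj_S\<close>)
  moreover have "?N = (if u < k then {} else {k..<n} - {u})" using assms by (auto simp: adj_S)
  ultimately show ?thesis using assms by (simp add: sum_diff1)
qed

lemma connected_KKK: "3 \<le> n \<Longrightarrow> connected_graph {0..<n} (KKK_edges n)"
  by (rule dominating_vertex(1)[OF simple_KKK, of 0]) (auto simp: adj_KKK)

lemma connected_S: "1 \<le> k \<Longrightarrow> k \<le> n \<Longrightarrow> connected_graph {0..<n} (S_edges n k)"
  by (rule dominating_vertex(1)[OF simple_S, of 0]) (auto simp: adj_S)

lemma gdist_KKK_le:
  assumes "3 \<le> n" "u \<in> {0..<n}" "w \<in> {0..<n}"
  shows "gdist {0..<n} (KKK_edges n) u w \<le> 2"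
proof -
  have "gdist {0..<n} (KKK_edges n) u w = (if u = w then 0 else if adj (KKK_edges n) u w then 1 else 2)"
    by (rule dominating_vertex(2)[OF simple_KKK, of 0]) (use assms in \<open>auto simp: adj_KKK\<close>)
  then show ?thesis by simp
qed

lemma gdist_S_le:
  assumes "1 \<le> k" "k \<le> n" "u \<in> {0..<n}" "w \<in> {0..<n}"
  shows "gdist {0..<n} (S_edges n k) u w \<le> 2"
proof -
  have "gdist {0..<n} (S_edges n k) u w = (if u = w then 0 else if adj (S_edges n k) u w then 1 else 2)"
    by (rule dominating_vertex(2)[OF simple_S, of 0]) (use assms in \<open>auto simp: adj_S\<close>)
  then show ?thesis by simp
qed

lemma sum_KKK_split:
  fixes z :: "nat \<Rightarrow> real"
  assumes "3 \<le> n" "\<And>u. 0 < u \<Longrightarrow> u < n - 1 \<Longrightarrow> z u = b"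
  shows "sum z {0..<n} = z 0 + (real n - 2) * b + z (n - 1)"
proof -
  have "sum z {0..<n} = sum z ({0..<n} - {0} - {n - 1}) + z 0 + z (n - 1)"
    using assms(1) by (simp add: sum_diff1)
  also have "{0..<n} - {0} - {n - 1} = {1..<n - 1}" using assms(1) by auto
  also have "sum z {1..<n - 1} = (\<Sum>u\<in>{1..<n - 1}. b)" using assms(2) by (intro sum.cong) auto
  finally show ?thesis using assms(1) by (simp add: of_nat_diff)
qed

text \<open>The test vector is a on the dominating vertex, b on the other clique vertices and c on
  the pendant vertex; the last three assumptions are the rows of the quotient matrix for this
  partition.\<close>

lemma KKK_upper:
  assumes "3 \<le> n" "0 < a" "0 < b" "0 < c"
    and "(real n - 2) * b + c \<le> M * a" "a + (real n - 3) * b + 2 * c \<le> M * b" "a + 2 * (real n - 2) * b \<le> M * c"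
  shows "dist_lambda1 {0..<n} (KKK_edges n) \<le> M"
proof -
  define y where "y u = (if u = 0 then a else if u = n - 1 then c else b)" for u
  have s: "sum y {0..<n} = a + (real n - 2) * b + c"
    using sum_KKK_split[of n y b] assms(1) by (simp add: y_def)
  show ?thesis
  proof (rule dist_lambda1_le[of _ y])
    fix u assume u: "u \<in> {0..<n}"
    show "0 < y u" using assms by (simp add: y_def)
    have "(\<Sum>w\<in>{0..<n}. dmat {0..<n} (KKK_edges n) u w * y w) = sum y {0..<n} - y u +
      (if u = 0 then 0 else if u = n - 1 then sum y {0..<n} - y 0 - y (n - 1) else y (n - 1))"
      using KKK_row_sum[OF assms(1)] u by simp
    also have "\<dots> \<le> M * y u" unfolding s using assms u by (auto simp: y_def algebra_simps)
    finally show "(\<Sum>w\<in>{0..<n}. dmat {0..<n} (KKK_edges n) u w * y w) \<le> M * y u" .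
  qed (use assms in auto)
qed

text \<open>With weights 1, 1, 2 the middle row equals n + 2 exactly, while the other two rows have
  slack.\<close>

lemma KKK_upper_n2: "3 \<le> n \<Longrightarrow> dist_lambda1 {0..<n} (KKK_edges n) \<le> real n + 2"
  by (rule KKK_upper[of n 1 1 2]) (auto simp: algebra_simps)

text \<open>The test vector is 1 on the clique and \<beta> on the independent set, with one
  assumption per row of the quotient matrix.\<close>

lemma S_upper:
  assumes "1 \<le> k" "k \<le> n" "0 < \<beta>"
    and "real k - 1 + (real n - real k) * \<beta> \<le> M" "real k + 2 * (real n - real k - 1) * \<beta> \<le> M * \<beta>"
  shows "dist_lambda1 {0..<n} (S_edges n k) \<le> M"
proof -
  define y where "y u = (if u < k then 1 else \<beta>)" for u
  have s2: "sum y {k..<n} = (real n - real k) * \<beta>"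
    using assms(2) by (simp add: y_def of_nat_diff)
  have "sum y {0..<n} = sum y {0..<k} + sum y {k..<n}" using assms(2) by (simp add: sum.atLeastLessThan_concat)
  moreover have "sum y {0..<k} = real k" by (simp add: y_def)
  ultimately have s: "sum y {0..<n} = real k + (real n - real k) * \<beta>" using s2 by simp
  show ?thesis
  proof (rule dist_lambda1_le[of _ y])
    fix u assume u: "u \<in> {0..<n}"
    show "0 < y u" using assms by (simp add: y_def)
    have "(\<Sum>w\<in>{0..<n}. dmat {0..<n} (S_edges n k) u w * y w) = sum y {0..<n} - y u +
      (if u < k then 0 else sum y {k..<n} - y u)"
      using S_row_sum[OF assms(1,2)] u by simp
    also have "\<dots> \<le> M * y u" unfolding s s2 using assms u by (auto simp: y_def algebra_simps)
    finally show "(\<Sum>w\<in>{0..<n}. dmat {0..<n} (S_edges n k) u w * y w) \<le> M * y u" .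
  qed (use assms in auto)
qed

text \<open>Constancy on the middle vertices follows from the eigenvalue equation itself, as (L + 1)
  z u equals the total sum plus c for each of them. Combining rows gives (L + 1)(2b - c) = a + 3c >
  0, which is the bound c < 2b; the final identity is the eigenvalue equation paired with the
  vector.\<close>

lemma KKK_perron:
  assumes n: "3 \<le> n" and L: "L = dist_lambda1 {0..<n} (KKK_edges n)"
  obtains a b c where "0 < a" "0 < b" "0 < c" "c < 2 * b"
    "L * (a\<^sup>2 + (real n - 2) * b\<^sup>2 + c\<^sup>2) =
      (a + (real n - 2) * b + c)\<^sup>2 - (a\<^sup>2 + (real n - 2) * b\<^sup>2 + c\<^sup>2) + 2 * (real n - 2) * b * c"
proof -
  obtain z where z: "eigenpair {0..<n} (dmat {0..<n} (KKK_edges n)) L z" "\<And>u. u \<in> {0..<n} \<Longrightarrow> 0 < z u"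
    using graph_perron_vector[OF _ _ connected_KKK[OF n]] n unfolding L by auto
  define a c \<sigma> where "a = z 0" and "c = z (n - 1)" and "\<sigma> = sum z {0..<n}"
  have row: "\<sigma> - z u + (if u = 0 then 0 else if u = n - 1 then \<sigma> - a - c else c) = L * z u" if "u < n" for u
    using KKK_row_sum[OF n that, of z] z(1) that unfolding eigenpair_def a_def c_def \<sigma>_def by simp
  have pos: "0 < a" "0 < c" "0 < \<sigma>" using n z(2) by (auto simp: a_def c_def \<sigma>_def intro!: sum_pos)
  have ra: "(L + 1) * a = \<sigma>" using row[of 0] n by (simp add: a_def algebra_simps)
  have L1: "0 < L + 1" using ra pos zero_less_mult_pos2[of "L + 1" a] by simp
  define b where "b = (\<sigma> + c) / (L + 1)"
  have rb: "(L + 1) * b = \<sigma> + c" using L1 by (simp add: b_def)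
  have zb: "z u = b" if "0 < u" "u < n - 1" for u
    using row[of u] that L1 unfolding b_def by (simp add: field_simps)
  have rc: "(L + 1) * c = 2 * \<sigma> - a - c" using row[of "n - 1"] n by (simp add: c_def algebra_simps)
  have s: "\<sigma> = a + (real n - 2) * b + c"
    unfolding \<sigma>_def a_def c_def using sum_KKK_split[OF n zb] by simp
  have b0: "0 < b" using pos L1 by (simp add: b_def)
  have "(L + 1) * (2 * b - c) = a + 3 * c" using rb rc by (simp add: algebra_simps)
  then have "0 < 2 * b - c" using pos L1 zero_less_mult_pos[of "L + 1" "2 * b - c"] by simp
  moreover have "(L + 1) * (a\<^sup>2 + (real n - 2) * b\<^sup>2 + c\<^sup>2) =
      ((L + 1) * a) * a + (real n - 2) * (((L + 1) * b) * b) + ((L + 1) * c) * c"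
    by (simp add: algebra_simps power2_eq_square)
  then have "(L + 1) * (a\<^sup>2 + (real n - 2) * b\<^sup>2 + c\<^sup>2) = \<sigma> * a + (real n - 2) * ((\<sigma> + c) * b) + (2 * \<sigma> - a - c) * c"
    unfolding ra rb rc .
  then have "(L + 1) * (a\<^sup>2 + (real n - 2) * b\<^sup>2 + c\<^sup>2) = \<sigma>\<^sup>2 + 2 * (real n - 2) * b * c"
    unfolding s by (simp add: algebra_simps power2_eq_square)
  ultimately show thesis using that[of a b c] pos b0 by (simp add: s algebra_simps)
qed

section \<open>Rayleigh bounds when at least as many vertices are isolated as deleted\<close>

lemma sum_constant_except:
  fixes g :: "'a \<Rightarrow> real"
  assumes "finite X" "p \<in> X" "\<And>u. u \<in> X \<Longrightarrow> u \<noteq> p \<Longrightarrow> g u = b"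
  shows "sum g X = g p + (real (card X) - 1) * b"
proof -
  have "sum g X = g p + sum g (X - {p})" by (rule sum.remove[OF assms(1,2)])
  also have "sum g (X - {p}) = (\<Sum>u\<in>X - {p}. b)" using assms(3) by (intro sum.cong) auto
  also have "\<dots> = (real (card X) - 1) * b" using card.remove[OF assms(1,2)] by simp
  finally show ?thesis .
qed

text \<open>A normal form: I is cut down to exactly s of the isolated vertices of G - S, and r
  counts all other vertices outside S, among which further isolated ones may occur.\<close>

locale barrier =
  fixes V :: "'a set" and E :: "'a set set" and S I :: "'a set" and s r :: nat
  assumes G: "simple_graph V E" "connected_graph V E"
    and S: "S \<subseteq> V" "I \<subseteq> isolated (adj E) (V - S)"
    and card_S: "card S = s" and card_I: "card I = s" and s_pos: "1 \<le> s" and card_V: "card V = 2 * s + r"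
begin

lemma fin: "finite V" "finite S" "finite I"
proof -
  show V: "finite V" using G(1) by (simp add: simple_graph_def)
  show "finite S" using S(1) V by (rule finite_subset)
  show "finite I" using S(2) V by (auto simp: isolated_def intro: finite_subset)
qed

lemma I_subset: "I \<subseteq> V - S"
  using S(2) by (auto simp: isolated_def)

lemma V_nonempty: "V \<noteq> {}"
  using S(1) card_S s_pos by auto

lemma card_J: "card (V - S - I) = r"
  using card_Diff_subset[OF fin(2) S(1)] card_Diff_subset[OF fin(3) I_subset] card_V card_S card_I by simp

text \<open>The vector is a at one vertex of S, c at one vertex of I and b everywhere else, so it
  takes the values of a Perron vector of \<open>KKK_edges\<close> and has the same norm.\<close>

lemma weighted_bound:
  assumes "0 \<le> a" "0 \<le> b" "0 \<le> c"
  shows "(a + (2 * real s + real r - 2) * b + c)\<^sup>2 - (a\<^sup>2 + (2 * real s + real r - 2) * b\<^sup>2 + c\<^sup>2)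
      + 2 * (c + (real s - 1) * b) * (real r * b) + (c + (real s - 1) * b)\<^sup>2 - (c\<^sup>2 + (real s - 1) * b\<^sup>2)
    \<le> dist_lambda1 V E * (a\<^sup>2 + (2 * real s + real r - 2) * b\<^sup>2 + c\<^sup>2)"
proof -
  obtain q where q: "q \<in> S" using card_S s_pos by fastforce
  obtain p where p: "p \<in> I" using card_I s_pos by fastforce
  have pq: "p \<noteq> q" "p \<in> V" "q \<in> V" "p \<notin> S" "q \<notin> I" using p q I_subset S(1) by auto
  define x where "x u = (if u = q then a else if u = p then c else b)" for u
  have sV: "sum g V = g q + g p + (real (card V) - 2) * b'" if "\<And>u. u \<noteq> q \<Longrightarrow> u \<noteq> p \<Longrightarrow> g u = b'" for g :: "'a \<Rightarrow> real" and b'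
  proof -
    have "sum g V = g q + sum g (V - {q})" by (rule sum.remove[OF fin(1) pq(3)])
    also have "sum g (V - {q}) = g p + (real (card (V - {q})) - 1) * b'"
      by (rule sum_constant_except) (use fin pq that in auto)
    also have "real (card (V - {q})) = real (card V) - 1" using card.remove[OF fin(1) pq(3)] by simp
    finally show ?thesis by (simp add: algebra_simps)
  qed
  have x: "x q = a" "x p = c" "\<And>u. u \<noteq> q \<Longrightarrow> u \<noteq> p \<Longrightarrow> x u = b" using pq by (auto simp: x_def)
  have nV: "real (card V) - 2 = 2 * real s + real r - 2" using card_V by simp
  have e1: "sum x V = a + (2 * real s + real r - 2) * b + c" using sV[of x b] x nV by simp
  have e2: "sq_sum V x = a\<^sup>2 + (2 * real s + real r - 2) * b\<^sup>2 + c\<^sup>2"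
    unfolding sq_sum_def using sV[of "\<lambda>u. (x u)\<^sup>2" "b\<^sup>2"] x nV by simp
  have e3: "sum x I = c + (real s - 1) * b"
    using sum_constant_except[OF fin(3) p, of x b] x pq card_I by (metis)
  have e4: "sq_sum I x = c\<^sup>2 + (real s - 1) * b\<^sup>2"
    unfolding sq_sum_def using sum_constant_except[OF fin(3) p, of "\<lambda>u. (x u)\<^sup>2" "b\<^sup>2"] x pq card_I by metis
  have e5: "sum x (V - S - I) = real r * b"
  proof -
    have "sum x (V - S - I) = (\<Sum>u\<in>V - S - I. b)" by (rule sum.cong[OF refl]) (metis Diff_iff x(3) p q)
    then show ?thesis using card_J by simp
  qed
  have x0: "\<And>u. 0 \<le> x u" using assms by (simp add: x_def)
  show ?thesis
    using rayleigh_barrier[OF G V_nonempty S, of x] x0 unfolding e1 e2 e3 e4 e5 by simp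
qed

text \<open>Weights 2 on S and 3 outside. When r is 0 or 1, all vertices outside S are independent
  in the join, so its Perron vector has two values; in the cases (s, r) = (2, 1), (3, 1), (5, 0)
  their ratio is about 1.46, exactly 1.5 and about 1.48.\<close>

lemma two_level_bound:
  "(2 * real s + 3 * (real s + real r))\<^sup>2 - (4 * real s + 9 * (real s + real r))
      + 18 * real s * real r + 9 * (real s)\<^sup>2 - 9 * real s
    \<le> dist_lambda1 V E * (4 * real s + 9 * (real s + real r))"
proof -
  define x where "x u = (if u \<in> S then 2 else 3 :: real)" for u
  have cVS: "card (V - S) = s + r" using card_Diff_subset[OF fin(2) S(1)] card_V card_S by simp
  have split: "sum g V = sum g S + sum g (V - S)" for g :: "'a \<Rightarrow> real"
    using sum.subset_diff[OF S(1) fin(1), of g] by simp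
  have xS: "sum x S = 2 * real s" "sum (\<lambda>u. (x u)\<^sup>2) S = 4 * real s" using card_S by (auto simp: x_def)
  have out: "sum x X = 3 * real (card X)" "sum (\<lambda>u. (x u)\<^sup>2) X = 9 * real (card X)" if "X \<subseteq> V - S" for X
  proof -
    have "sum x X = (\<Sum>u\<in>X. 3)" by (rule sum.cong) (use that in \<open>auto simp: x_def\<close>)
    moreover have "sum (\<lambda>u. (x u)\<^sup>2) X = (\<Sum>u\<in>X. 9)" by (rule sum.cong) (use that in \<open>auto simp: x_def\<close>)
    ultimately show "sum x X = 3 * real (card X)" "sum (\<lambda>u. (x u)\<^sup>2) X = 9 * real (card X)" by auto
  qed
  have "sum x V = 2 * real s + 3 * (real s + real r)" using split[of x] xS out[of "V - S"] cVS by simp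
  moreover have "sq_sum V x = 4 * real s + 9 * (real s + real r)"
    unfolding sq_sum_def using split[of "\<lambda>u. (x u)\<^sup>2"] xS out[of "V - S"] cVS by simp
  moreover have "sum x I = 3 * real s" "sq_sum I x = 9 * real s"
    unfolding sq_sum_def using out[OF I_subset] card_I by auto
  moreover have "sum x (V - S - I) = 3 * real r" using out[of "V - S - I"] card_J by auto
  ultimately show ?thesis
    using rayleigh_barrier[OF G V_nonempty S, of x] by (simp add: x_def algebra_simps power2_eq_square)
qed

text \<open>The same vector is used on both sides, so only the contributions of nonadjacent pairs
  have to be compared.\<close>

lemma KKK_less:
  assumes "2 \<le> s" "6 \<le> 2 * r + s"
  shows "dist_lambda1 {0..<card V} (KKK_edges (card V)) < dist_lambda1 V E"
proof (rule ccontr)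
  let ?n = "card V"
  define L where "L = dist_lambda1 {0..<?n} (KKK_edges ?n)"
  assume "\<not> dist_lambda1 {0..<?n} (KKK_edges ?n) < dist_lambda1 V E"
  then have le: "dist_lambda1 V E \<le> L" by (simp add: L_def)
  have n: "3 \<le> ?n" using card_V assms by linarith
  obtain a b c where abc: "0 < a" "0 < b" "0 < c" "c < 2 * b"
    and eq: "L * (a\<^sup>2 + (real ?n - 2) * b\<^sup>2 + c\<^sup>2) =
      (a + (real ?n - 2) * b + c)\<^sup>2 - (a\<^sup>2 + (real ?n - 2) * b\<^sup>2 + c\<^sup>2) + 2 * (real ?n - 2) * b * c"
    by (rule KKK_perron[OF n L_def])
  define t where "t = 2 * real s + real r - 2"
  have t: "real ?n - 2 = t" using card_V by (simp add: t_def)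
  have t0: "0 \<le> t" using assms by (simp add: t_def)
  have "dist_lambda1 V E * (a\<^sup>2 + t * b\<^sup>2 + c\<^sup>2) \<le> L * (a\<^sup>2 + t * b\<^sup>2 + c\<^sup>2)"
    using le t0 by (intro mult_right_mono) auto
  then have "2 * (c + (real s - 1) * b) * (real r * b) + (c + (real s - 1) * b)\<^sup>2 - (c\<^sup>2 + (real s - 1) * b\<^sup>2)
      \<le> 2 * t * b * c"
    using weighted_bound[of a b c] abc eq unfolding t t_def[symmetric] by linarith
  \<comment> \<open>The difference of the two forms factors; for s \<ge> 2 its sign is that of (2r +
    s - 2) b - 2c. This is positive because 2r + s - 2 \<ge> 4 and c < 2b, which is where the
    threshold 6 comes from.\<close>
  then have "((real s - 1) * b) * (2 * real r * b + (real s - 2) * b - 2 * c) \<le> 0"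
    unfolding t_def by (simp add: algebra_simps power2_eq_square)
  moreover have "0 < (real s - 1) * b" using assms abc by simp
  moreover have "4 * b \<le> (2 * real r + real s - 2) * b"
    using assms(2) abc(2) by (intro mult_right_mono) auto
  then have "0 < 2 * real r * b + (real s - 2) * b - 2 * c" using abc(4) by (simp add: algebra_simps)
  ultimately show False using mult_pos_pos by (metis not_le)
qed

end

section \<open>Noncritical graphs\<close>

text \<open>With i isolated vertices, q large components covering at least 3q of the m other
  vertices outside S, and i < s, the hypothesis gives q \<ge> 3 and m \<ge> 9, so n \<ge> 10. More
  than 3n ordered nonadjacent pairs lift the average row sum of the distance matrix above (n - 1) +
  3 = n + 2.\<close>

lemma many_components_bound:
  assumes G: "simple_graph V E" "connected_graph V E" and S: "S \<subseteq> V" "S \<noteq> {}"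
    and lt: "card (isolated (adj E) (V - S)) < card S"
    and q: "3 * card S \<le> 3 * card (isolated (adj E) (V - S)) + card {C \<in> conn_comps (adj E) (V - S). 3 \<le> card C}"
  shows "10 \<le> card V" and "real (card V) + 2 < dist_lambda1 V E"
proof -
  let ?A = "adj E" and ?W = "V - S"
  let ?I = "isolated ?A ?W" and ?Q = "{C \<in> conn_comps ?A ?W. 3 \<le> card C}"
  define n s i q m where "n = card V" and "s = card S" and "i = card ?I" and "q = card ?Q" and "m = card (?W - ?I)"
  have fin: "finite V" using G(1) by (simp add: simple_graph_def)
  have finW: "finite ?W" and finS: "finite S" and finI: "finite ?I"
    using fin S(1) by (auto simp: isolated_def intro: finite_subset)
  have IW: "?I \<subseteq> ?W" by (auto simp: isolated_def)
  have finC: "finite C" if "C \<in> ?Q" for C using that by (intro finite_subset[OF conn_comps_subset finW]) blast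
  have cW: "card ?W + s = n" unfolding n_def s_def using card_Diff_subset[OF finS S(1)] card_mono[OF fin S(1)] by simp
  have cI: "m + i = card ?W" unfolding m_def i_def
    using card_Diff_subset[OF finI IW] card_mono[OF finW IW] by simp
  have disj: "pairwise disjnt ?Q"
    by (rule pairwiseI) (use conn_comps_disjoint[OF symp_adj, of _ E ?W] in \<open>auto simp: disjnt_iff\<close>)
  have card_Union: "3 * card X \<le> card (\<Union>X)" if X: "X \<subseteq> ?Q" for X
  proof -
    have "card (\<Union>X) = sum card X"
    proof (rule card_Union_disjoint)
      show "pairwise disjnt X" by (rule pairwise_subset[OF disj X])
      show "finite C" if "C \<in> X" for C using that X finC by blast
    qed
    moreover have "(\<Sum>C\<in>X. 3) \<le> sum card X" using X by (intro sum_mono) auto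
    ultimately show ?thesis by simp
  qed
  have "\<Union>?Q \<subseteq> ?W - ?I"
  proof
    fix x assume "x \<in> \<Union>?Q"
    then obtain C where C: "C \<in> conn_comps ?A ?W" "3 \<le> card C" "x \<in> C" by blast
    have xW: "x \<in> ?W" using conn_comps_subset[OF C(1)] C(3) by blast
    have "x \<notin> ?I"
    proof
      assume "x \<in> ?I"
      then have "conn_comp ?A ?W x = {x}" by (rule conn_comp_isolated)
      moreover have "conn_comp ?A ?W x \<in> conn_comps ?A ?W" using xW by (auto simp: conn_comps_def)
      ultimately have "C = {x}" using conn_comps_disjoint[OF symp_adj C(1) _ C(3), of "conn_comp ?A ?W x"] by simp
      then show False using C(2) by simp
    qed
    then show "x \<in> ?W - ?I" using xW by blast
  qed
  then have "card (\<Union>?Q) \<le> m" unfolding m_def using finW by (intro card_mono) auto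
  then have m3: "3 * q \<le> m" using card_Union[of ?Q] unfolding q_def by simp
  have qs: "3 * s \<le> 3 * i + q" using q unfolding q_def s_def i_def by simp
  have is': "i < s" using lt by (simp add: i_def s_def)
  have m9: "9 * s \<le> 9 * i + m" using m3 qs by simp
  have "10 \<le> n" using m9 is' cW cI by linarith
  then show "10 \<le> card V" by (simp add: n_def)
  let ?N = "\<lambda>u. {w \<in> V. w \<noteq> u \<and> \<not> adj E u w}"
  have NI: "i + m - 1 \<le> card (?N u)" if u: "u \<in> ?I" for u
  proof -
    have "?W - {u} \<subseteq> ?N u" using u by (auto simp: isolated_def)
    then have "card (?W - {u}) \<le> card (?N u)" using fin by (intro card_mono) auto
    moreover have "card (?W - {u}) = i + m - 1" using u IW cI by (subst card_Diff_singleton) auto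
    ultimately show ?thesis by simp
  qed
  \<comment> \<open>At least two components of order three or more avoid the component of u, and u
    is adjacent to none of their vertices.\<close>
  have NJ: "6 \<le> card (?N u)" if u: "u \<in> ?W - ?I" for u
  proof -
    let ?C = "conn_comp ?A ?W u"
    have C: "?C \<in> conn_comps ?A ?W" using u by (auto simp: conn_comps_def)
    have "\<Union>(?Q - {?C}) \<subseteq> ?N u"
    proof
      fix w assume "w \<in> \<Union>(?Q - {?C})"
      then obtain D where D: "D \<in> conn_comps ?A ?W" "D \<noteq> ?C" "w \<in> D" by blast
      then have wW: "w \<in> ?W" and wC: "w \<notin> ?C"
        using conn_comps_subset[OF D(1)] conn_comps_disjoint[OF symp_adj D(1) C D(3)] by auto
      then show "w \<in> ?N u"
        using conn_comp_self[of u ?A ?W] conn_comps_closed[OF C, of u w] by auto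
    qed
    then have "card (\<Union>(?Q - {?C})) \<le> card (?N u)" using fin by (intro card_mono) auto
    moreover have "3 * card (?Q - {?C}) \<le> card (\<Union>(?Q - {?C}))" by (rule card_Union) blast
    moreover have "q \<le> card (?Q - {?C}) + 1"
      unfolding q_def using card_Diff_singleton_if[of ?Q ?C] by (auto split: if_splits)
    ultimately show ?thesis using qs is' by linarith
  qed
  have "i * (i + m - 1) + 6 * m \<le> (\<Sum>u\<in>V. card (?N u))"
  proof -
    have "i * (i + m - 1) \<le> (\<Sum>u\<in>?I. card (?N u))"
      using sum_bounded_below[of ?I "i + m - 1" "\<lambda>u. card (?N u)"] NI by (simp add: i_def)
    moreover have "6 * m \<le> (\<Sum>u\<in>?W - ?I. card (?N u))"
      using sum_bounded_below[of "?W - ?I" 6 "\<lambda>u. card (?N u)"] NJ by (simp add: m_def)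
    moreover have "(\<Sum>u\<in>?I. card (?N u)) + (\<Sum>u\<in>?W - ?I. card (?N u)) = (\<Sum>u\<in>?W. card (?N u))"
      using sum.subset_diff[OF IW finW, of "\<lambda>u. card (?N u)"] by simp
    moreover have "(\<Sum>u\<in>?W. card (?N u)) \<le> (\<Sum>u\<in>V. card (?N u))"
      using fin by (intro sum_mono2) auto
    ultimately show ?thesis by linarith
  qed
  \<comment> \<open>Since m \<ge> 9, the factor i + m - 1 can be replaced by 8. The claim becomes
    linear: 8i + 6m exceeds 3(s + i + m) because 9s \<le> 9i + m.\<close>
  moreover have "3 * n < i * (i + m - 1) + 6 * m"
  proof -
    have "i * 8 \<le> i * (i + m - 1)" using m9 is' by (intro mult_left_mono) linarith+
    then show ?thesis using m9 is' cW cI by linarith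
  qed
  ultimately have "3 * n < (\<Sum>u\<in>V. card (?N u))" by linarith
  then have sum3: "3 * real n < (\<Sum>u\<in>V. real (card (?N u)))"
    unfolding of_nat_sum[symmetric] by linarith
  have "V \<noteq> {}" using S by blast
  then have "real n * (real n - 1) + (\<Sum>u\<in>V. real (card (?N u))) \<le> dist_lambda1 V E * real n"
    unfolding n_def by (rule rayleigh_nonadjacent[OF G])
  then have "(real n + 2) * real n < dist_lambda1 V E * real n" using sum3 by (simp add: algebra_simps)
  then show "real (card V) + 2 < dist_lambda1 V E" using \<open>10 \<le> n\<close> by (simp add: n_def)
qed

lemma bij_betw_glue:
  assumes "finite A" "finite B" "finite C" "finite D" "card A = card B" "card C = card D"
    "A \<inter> C = {}" "B \<inter> D = {}"
  obtains f where "bij_betw f (A \<union> C) (B \<union> D)" "bij_betw f A B" "bij_betw f C D"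
proof -
  obtain g h where g: "bij_betw g A B" and h: "bij_betw h C D"
    using finite_same_card_bij assms by metis
  define f where "f u = (if u \<in> A then g u else h u)" for u
  have fA: "bij_betw f A B" using g by (rule bij_betw_cong[THEN iffD1, rotated]) (simp add: f_def)
  have fC: "bij_betw f C D" using h by (rule bij_betw_cong[THEN iffD1, rotated]) (use assms(7) in \<open>auto simp: f_def\<close>)
  show thesis using that[OF bij_betw_combine[OF fA fC assms(8)] fA fC] .
qed

section \<open>Identifying the extremal graphs and excluding the remaining parameters\<close>

context barrier
begin

lemma nonadj_I: "u \<in> I \<Longrightarrow> w \<in> V - S \<Longrightarrow> \<not> adj E u w"
  using S(2) by (auto simp: isolated_def)

text \<open>For s = 1 the only possible neighbour of the vertex p of I is the vertex c of S. Sending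
  p to n - 1 and c to 0 embeds G as a spanning subgraph of the extremal graph.\<close>

lemma KKK_iso:
  assumes "s = 1" "3 \<le> card V" "dist_lambda1 V E \<le> dist_lambda1 {0..<card V} (KKK_edges (card V))"
  shows "graph_iso V E {0..<card V} (KKK_edges (card V))"
proof -
  let ?n = "card V"
  obtain p where p: "I = {p}" using card_I assms(1) card_1_singletonE by metis
  obtain c where c: "S = {c}" using card_S assms(1) card_1_singletonE by metis
  have pV: "p \<in> V" "p \<noteq> c" "c \<in> V" using I_subset S(1) p c by auto
  have cV: "card (V - {p}) = ?n - 1" "card (V - {p} - {c}) = ?n - 2"
    using pV fin by (auto simp: card_Diff_singleton_if)
  obtain g where g: "bij_betw g ({c} \<union> (V - {p} - {c})) ({0} \<union> {1..<?n - 1})" "bij_betw g {c} {0}"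
    by (rule bij_betw_glue[of "{c}" "{0::nat}" "V - {p} - {c}" "{1..<?n - 1}"]) (use cV fin in auto)
  have e1: "{c} \<union> (V - {p} - {c}) = V - {p}" "{0} \<union> {1..<?n - 1} = {0..<?n - 1}" using pV assms(2) by auto
  define f where "f = g(p := ?n - 1)"
  have f1: "bij_betw f (V - {p}) {0..<?n - 1}"
    using g(1) unfolding e1 by (rule bij_betw_cong[THEN iffD1, rotated]) (auto simp: f_def)
  have f2: "bij_betw f {p} {?n - 1}" by (simp add: f_def bij_betw_def)
  have "bij_betw f (V - {p} \<union> {p}) ({0..<?n - 1} \<union> {?n - 1})"
    by (rule bij_betw_combine[OF f1 f2]) simp
  moreover have "V - {p} \<union> {p} = V" "{0..<?n - 1} \<union> {?n - 1} = {0..<?n}" using pV assms(2) by auto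
  ultimately have f: "bij_betw f V {0..<?n}" by simp
  have fc: "f c = 0" using g(2) pV by (simp add: f_def bij_betw_def)
  have fin': "f u < ?n" if "u \<in> V" for u using f that bij_betwE by fastforce
  have fi: "f u < ?n - 1" if "u \<in> V" "u \<noteq> p" for u using f1 that bij_betwE by fastforce
  show ?thesis
  proof (rule dist_lambda1_spanning_subgraph[OF G simple_KKK connected_KKK[OF assms(2)] _ gdist_KKK_le[OF assms(2)] f _ assms(3)])
    show "{0..<?n} \<noteq> {}" using assms(2) by simp
    fix u w assume uw: "u \<in> V" "w \<in> V" "{u, w} \<in> E"
    then have "adj E u w" by (simp add: adj_def)
    then have "u \<noteq> w" using irreflp_adj[OF G(1)] by (auto simp: irreflp_def)
    then have "f u \<noteq> f w" using f uw by (auto simp: bij_betw_def inj_on_def)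
    moreover have "u = p \<Longrightarrow> w = c" using nonadj_I[of p w] p c uw \<open>adj E u w\<close> by auto
    moreover have "w = p \<Longrightarrow> u = c"
      using nonadj_I[of p u] p c uw sympD[OF symp_adj \<open>adj E u w\<close>] by auto
    ultimately have "adj (KKK_edges ?n) (f u) (f w)"
      unfolding adj_KKK using fin'[OF uw(1)] fin'[OF uw(2)] fi[OF uw(1)] fi[OF uw(2)] fc by metis
    then show "{f u, f w} \<in> KKK_edges ?n" by (simp add: adj_def)
  qed auto
qed

text \<open>For r = 0 the set I is all of V - S, so every edge meets S. Sending S onto the clique
  {0..<s} maps edges to edges.\<close>

lemma S_iso:
  assumes "r = 0" "dist_lambda1 V E \<le> dist_lambda1 {0..<card V} (S_edges (card V) s)"
  shows "graph_iso V E {0..<card V} (S_edges (card V) s)"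
proof -
  let ?n = "card V"
  have n: "?n = 2 * s" using card_V assms(1) by simp
  have VSI: "V - S = I" using card_J assms(1) fin I_subset by auto
  obtain f where f: "bij_betw f (S \<union> I) ({0..<s} \<union> {s..<?n})" "bij_betw f S {0..<s}" "bij_betw f I {s..<?n}"
    by (rule bij_betw_glue[of S "{0..<s}" I "{s..<?n}"]) (use fin card_S card_I n I_subset in auto)
  have "S \<union> I = V" "{0..<s} \<union> {s..<?n} = {0..<?n}" using VSI S(1) n by auto
  then have fV: "bij_betw f V {0..<?n}" using f(1) by simp
  have sn: "s \<le> ?n" using n by simp
  have fin': "f u < ?n" if "u \<in> V" for u using fV that bij_betwE by fastforce
  have fS: "f u < s" if "u \<in> S" for u using f(2) that bij_betwE by fastforce
  show ?thesis
  proof (rule dist_lambda1_spanning_subgraph[OF G simple_S connected_S[OF s_pos sn] _ gdist_S_le[OF s_pos sn] fV _ assms(2)])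
    show "{0..<?n} \<noteq> {}" using n s_pos by simp
    fix u w assume uw: "u \<in> V" "w \<in> V" "{u, w} \<in> E"
    then have "adj E u w" by (simp add: adj_def)
    then have "u \<noteq> w" using irreflp_adj[OF G(1)] by (auto simp: irreflp_def)
    then have "f u \<noteq> f w" using fV uw by (auto simp: bij_betw_def inj_on_def)
    moreover have "u \<in> S \<or> w \<in> S" using nonadj_I[of u w] \<open>adj E u w\<close> uw VSI by blast
    ultimately have "adj (S_edges ?n s) (f u) (f w)"
      unfolding adj_S using fin'[OF uw(1)] fin'[OF uw(2)] fS by blast
    then show "{f u, f w} \<in> S_edges ?n s" by (simp add: adj_def)
  qed auto
qed

lemma KKK_case:
  assumes "3 \<le> card V" "odd (card V) \<or> 10 \<le> card V"
    and le: "dist_lambda1 V E \<le> dist_lambda1 {0..<card V} (KKK_edges (card V))"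
  shows "graph_iso V E {0..<card V} (KKK_edges (card V))"
proof (cases "s = 1")
  case True
  then show ?thesis using KKK_iso assms by blast
next
  case False
  then have s2: "2 \<le> s" using s_pos by simp
  have small: "2 * r + s < 6" using KKK_less[OF s2] le by (metis not_le)
  \<comment> \<open>These are the pairs with s \<ge> 2 and 2r + s < 6 for which n = 2s + r is odd or
    at least 10; the excluded even orders are 4, 6 and 8.\<close>
  have "(s = 2 \<and> r = 1) \<or> (s = 3 \<and> r = 1) \<or> (s = 5 \<and> r = 0)"
  proof -
    have "r = 0 \<or> r = 1" "s = 2 \<or> s = 3 \<or> s = 4 \<or> s = 5" using small s2 by linarith+
    then show ?thesis using small assms(2) card_V by auto
  qed
  \<comment> \<open>All rational weights below are roundings of Perron vectors.\<close>
  then consider "s = 2" "r = 1" | "s = 3" "r = 1" | "s = 5" "r = 0" by blast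
  then have False
  proof cases
    case 1
    then have n: "card V = 5" using card_V by simp
    have "dist_lambda1 {0..<5} (KKK_edges 5) \<le> 536 / 100"
      by (rule KKK_upper[of 5 "8 / 10" 1 "127 / 100"]) auto
    then show False using le two_level_bound unfolding n 1 by (simp add: power2_eq_square)
  next
    case 2
    then have n: "card V = 7" using card_V by simp
    have "dist_lambda1 {0..<7} (KKK_edges 7) \<le> 79 / 10"
      by (rule KKK_upper[of 7 "9 / 10" 1 "14 / 10"]) auto
    then show False using le two_level_bound unfolding n 2 by (simp add: power2_eq_square)
  next
    case 3
    then have n: "card V = 10" using card_V by simp
    have "dist_lambda1 {0..<10} (KKK_edges 10) \<le> 113 / 10"
      by (rule KKK_upper[of 10 "9 / 10" 1 "15 / 10"]) auto
    then show False using le two_level_bound unfolding n 3 by (simp add: power2_eq_square)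
  qed
  then show ?thesis ..
qed

text \<open>For even n the number r is even, so either r = 0 and G spans a subgraph of the extremal
  graph, or r \<ge> 2. The latter leaves six pairs (s, r) with n \<le> 8, each excluded
  numerically.\<close>

lemma S_case:
  assumes "even (card V)" "4 \<le> card V" "card V \<le> 8"
    and le: "dist_lambda1 V E \<le> dist_lambda1 {0..<card V} (S_edges (card V) (card V div 2))"
  shows "graph_iso V E {0..<card V} (S_edges (card V) (card V div 2))"
proof (cases "r = 0")
  case True
  then have "card V div 2 = s" using card_V by simp
  then show ?thesis using S_iso[OF True] le by simp
next
  case False
  have "even r" using assms(1) card_V by simp
  then have "2 \<le> r" using False by (cases "r = 1") auto
  then have "(s = 1 \<and> r = 2) \<or> (s = 1 \<and> r = 4) \<or> (s = 2 \<and> r = 2) \<or> (s = 1 \<and> r = 6) \<or> (s = 2 \<and> r = 4) \<or> (s = 3 \<and> r = 2)"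
  proof -
    have "r = 2 \<or> r = 3 \<or> r = 4 \<or> r = 5 \<or> r = 6" "s = 1 \<or> s = 2 \<or> s = 3"
      using \<open>2 \<le> r\<close> s_pos assms(3) card_V by linarith+
    then show ?thesis using \<open>even r\<close> assms(3) card_V by auto
  qed
  \<comment> \<open>The bounds 3.6, 6.2 and 8.775 lie just above the exact radii (3 + sqrt 17) / 2,
    3 + sqrt 10 and (9 + sqrt 73) / 2.\<close>
  note ones = weighted_bound[of 1 1 1] and S4 = S_upper[of 2 4 "128 / 100" "36 / 10"]
    and S6 = S_upper[of 3 6 "139 / 100" "62 / 10"] and S8 = S_upper[of 4 8 "1443 / 1000" "8775 / 1000"]
  from \<open>_ \<or> _\<close> consider "s = 1" "r = 2" | "s = 1" "r = 4" | "s = 2" "r = 2" | "s = 1" "r = 6" | "s = 2" "r = 4" | "s = 3" "r = 2"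
    by blast
  then have False
  proof cases
    case 1
    then have n: "card V = 4" using card_V by simp
    show False using le ones S4 unfolding n 1 by (simp add: power2_eq_square)
  next
    case 2
    then have n: "card V = 6" using card_V by simp
    show False using le ones S6 unfolding n 2 by (simp add: power2_eq_square)
  next
    case 3
    then have n: "card V = 6" using card_V by simp
    show False using le ones S6 unfolding n 3 by (simp add: power2_eq_square)
  next
    case 4
    then have n: "card V = 8" using card_V by simp
    \<comment> \<open>The closest comparison: all-ones yields only 8.5, whereas this approximate
      Perron vector yields about 8.7768 against the bound 8.775. This is why the weights for n = 8
      need three decimals.\<close>
    show False using le weighted_bound[of "85 / 100" 1 "15 / 10"] S8 unfolding n 4
      by (simp add: power2_eq_square)
  next
    case 5
    then have n: "card V = 8" using card_V by simp
    show False using le ones S8 unfolding n 5 by (simp add: power2_eq_square)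
  next
    case 6
    then have n: "card V = 8" using card_V by simp
    show False using le ones S8 unfolding n 6 by (simp add: power2_eq_square)
  qed
  then show ?thesis ..
qed

end

theorem theorem2:
  fixes V :: "'a set" and E :: "'a set set" and k d n :: nat
  assumes "simple_graph V E" and "connected_graph V E"
    and "n = card V" and "n \<ge> 3"
    and "odd k" and "k \<ge> 3" and "1 \<le> d" and "d < k"
    and "n mod 2 = d mod 2"
  shows "((odd n \<or> n \<ge> 10) \<and>
            dist_lambda1 V E \<le> dist_lambda1 {0..<n} (KKK_edges n)
          \<longrightarrow> k_d_critical V E k d \<or> graph_iso V E {0..<n} (KKK_edges n))
       \<and> ((even n \<and> 4 \<le> n \<and> n \<le> 8) \<and>
            dist_lambda1 V E \<le> dist_lambda1 {0..<n} (S_edges n (n div 2))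
          \<longrightarrow> k_d_critical V E k d \<or> graph_iso V E {0..<n} (S_edges n (n div 2)))"
proof (cases "k_d_critical V E k d")
  case False
  have fin: "finite V" using assms(1) by (simp add: simple_graph_def)
  obtain S where S: "S \<subseteq> V" "S \<noteq> {}" and dich: "card S \<le> card (isolated (adj E) (V - S)) \<or>
      3 * card S \<le> 3 * card (isolated (adj E) (V - S)) + card {C \<in> conn_comps (adj E) (V - S). 3 \<le> card C}"
    using noncritical_barrier[OF assms(1,2) _ assms(5-8) _ False] assms(3,4,9) by auto
  show ?thesis
  proof (cases "card S \<le> card (isolated (adj E) (V - S))")
    case True
    \<comment> \<open>Only as many isolated vertices as S has elements are kept; the surplus joins
      the r remaining vertices.\<close>
    then obtain I where I: "I \<subseteq> isolated (adj E) (V - S)" "card I = card S"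
      using obtain_subset_with_card_n by metis
    have finS: "finite S" and finI: "finite I" and IS: "I \<inter> S = {}" "I \<subseteq> V"
      using S(1) I(1) fin by (auto simp: isolated_def intro: finite_subset)
    have "card (S \<union> I) = 2 * card S" using finS finI IS I(2) by (subst card_Un_disjoint) auto
    moreover have "card (S \<union> I) \<le> card V" using S(1) IS(2) fin by (intro card_mono) auto
    ultimately interpret barrier V E S I "card S" "card V - 2 * card S"
      by unfold_locales (use assms(1,2) S I finS in \<open>auto simp: Suc_le_eq card_gt_0_iff\<close>)
    show ?thesis using KKK_case S_case assms(3,4) by blast
  next
    case few: False
    then have lt: "card (isolated (adj E) (V - S)) < card S" by simp
    \<comment> \<open>Here n \<ge> 10 contradicts the range of the second part, and a radius above n
      + 2 contradicts the spectral hypothesis of the first.\<close>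
    show ?thesis using few dich many_components_bound[OF assms(1,2) S lt] KKK_upper_n2[OF assms(4)] assms(3) by linarith
  qed
qed simp

end
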